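(* Let $X,Y,Z$ be real Hilbert spaces, let $\pi:X\to Z$ be a continuous linear operator, let $W$ be a reflexive Banach space, and let $U$ be a nonempty weakly closed subset of $W$. For each $p\in U$ let $A_p:X\to X$ be $(m_p,L_p)$-strongly monotone Lipschitz, let $\mathcal S_p:C(\mathbb R_+;X)\to C(\mathbb R_+;X)$ be history-dependent with constants $(s_m^p)_{m\in\mathbb N}$, let $b_p:X\times Y\to\mathbb R$ be an $(M_p,\alpha_p)$-inf-sup bilinear form, let $\Lambda_p\subset Y$ be closed and convex with $0_Y\in\Lambda_p$, and let $\widetilde f_p\in Z$, $\widetilde h_p\in X$. Let $\theta,\zeta\in C(\mathbb R_+;\mathbb R)$ and set $f_p(t)=\theta(t)\widetilde f_p$, $h_p(t)=\zeta(t)\widetilde h_p$ for $t\in\mathbb R_+$. For each $p\in U$ let $(u_p,\lambda_p)\in C(\mathbb R_+;X\times\Lambda_p)$ be the unique solution of: for all $t\in\mathbb R_+$, $$(A_pu_p(t),v)_X+(\mathcal S_pu_p(t),v)_X+b_p(v,\lambda_p(t))=(f_p(t),\pi v)_Z\quad\forall v\in X,$$ $$b_p(u_p(t),\mu-\lambda_p(t))\le b_p(h_p(t),\mu-\lambda_p(t))\quad\forall\mu\in\Lambda_p.$$ Let $\mathcal L:X\times Y\times U\to\mathbb R$ be such that for all sequences $\{u_n\}\subset X$, $\{\lambda_n\}\subset Y$, $\{p_n\}\subset U$ with $u_n\to u$ in $X$, $\lambda_n\rightharpoonup\lambda$ in $Y$, $p_n\rightharpoonup p$ in $W$, one has $\liminf_n\mathcal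 L(u_n,\lambda_n,p_n)\ge\mathcal L(u,\lambda,p)$. Assume that at least one of the following holds: (i) there is $z:U\to\mathbb R$ such that $\mathcal L(u,\lambda,p)\ge z(p)$ for all $u\in X,\lambda\in Y,p\in U$, and $z(p_n)\to\infty$ for every sequence $\{p_n\}\subset U$ with $\|p_n\|_W\to+\infty$; (ii) $U$ is a bounded subset of $W$. Assume in addition that for each sequence $\{p_n\}\subset U$ with $p_n\rightharpoonup p$ in $W$ the following hold: (1) for each $n$ there are $F_n\ge0$, $\delta_n\ge0$ with $\|A_{p_n}v-A_pv\|_X\le F_n(\|v\|_X+\delta_n)$ for all $v\in X$; moreover $F_n\to0$ and $\{\delta_n\}$ is bounded; (2) there are $m_0,L_0>0$ with $m_{p_n}\ge m_0$ and $L_{p_n}\le L_0$ for all $n$; (3) for all $n,m\in\mathbb N$ there are $F_n^m\ge0$, $\delta_n^m\ge0$ with $\|\mathcal S_{p_n}v(t)-\mathcal S_pv(t)\|_X\le F_n^m\big(\max_{s\in[0,m]}\|v(s)\|_X+\delta_n^m\big)$ for all $v\in C(\mathbb R_+;X)$, $t\in[0,m]$; moreover, for every $m$, $\lim_{n\to\infty}F_n^m=0$ and $\{\delta_n^m\}_n$ is bounded; (4) for each $m\in\mathbb N$ there is $s_m^0>0$ with $s_m^{p_n}\le s_m^0$ for all $n$; (5) whenever $z_n\rightharpoonup z$ in $X$ and $\mu_n\rightharpoonup\mu$ in $Y$, one has $\limsup_n b_{p_n}(w-z_n,\mu_n)\le b_p(w-z,\mu)$ for all $w\in X$; (6) there are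 $\alpha_0,M_0>0$ with $\alpha_{p_n}\ge\alpha_0$ and $M_{p_n}\le M_0$ for all $n$; (7) whenever $v_n\rightharpoonup v$ in $X$, one has $\pi v_n\to\pi v$ in $Z$; (8) $\{\Lambda_{p_n}\}$ converges to $\Lambda_p$ in the sense of Mosco: (a) for each $\mu\in\Lambda_p$ there is a sequence with $\mu_n\in\Lambda_{p_n}$ for all $n$ and $\mu_n\to\mu$ in $Y$; (b) if $\mu_n\in\Lambda_{p_n}$ for all $n$ and $\mu_n\rightharpoonup\mu$ in $Y$, then $\mu\in\Lambda_p$; (9) $\widetilde f_{p_n}\rightharpoonup\widetilde f_p$ in $Z$ and $\widetilde h_{p_n}\rightharpoonup\widetilde h_p$ in $X$. Then for each $t\in\mathbb R_+$ there exists at least one $p^*\in U$ such that $$\mathcal L(u_{p^*}(t),\lambda_{p^*}(t),p^* )=\min_{p\in U}\mathcal L(u_p(t),\lambda_p(t),p).$$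
   Context: $\mathbb R_+=[0,+\infty)$; $C(\mathbb R_+;E)$ is the set of continuous functions from $\mathbb R_+$ to $E$. The symbols $\to$ and $\rightharpoonup$ denote strong and weak convergence; limits are as $n\to\infty$. - For $m_A,L_A>0$, $A:X\to X$ (possibly nonlinear) is called $(m_A,L_A)$-strongly monotone Lipschitz if $(Au-Av,u-v)_X\ge m_A\|u-v\|_X^2$ and $\|Au-Av\|_X\le L_A\|u-v\|_X$ for all $u,v\in X$. - $\mathcal S:C(\mathbb R_+;X)\to C(\mathbb R_+;X)$ is called history-dependent with constants $s_m\ge0$ ($m\in\mathbb N$) if for each $m\in\mathbb N$: $\|\mathcal Su_1(t)-\mathcal Su_2(t)\|_X\le s_m\int_0^t\|u_1(s)-u_2(s)\|_X\,ds$ for all $u_1,u_2\in C(\mathbb R_+;X)$, $t\in[0,m]$. - For $M_b,\alpha_b>0$, a bilinear form $b:X\times Y\to\mathbb R$ is called an $(M_b,\alpha_b)$-inf-sup bilinear form if $|b(v,\mu)|\le M_b\|v\|_X\|\mu\|_Y$ for all $v\in X,\mu\in Y$, and $\inf_{\mu\in Y,\mu\ne0_Y}\sup_{v\in X,v\ne0_X}\frac{b(v,\mu)}{\|v\|_X\|\mu\|_Y}\ge\alpha_b$. Under the stated hypotheses the mixed problem is uniquely solvable for each $p\in U$, with the stated regularity. Since $U$ is weakly closed, a weak limit $p$ of a sequence in $U$ belongs to $U$. *)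

theory Defs
  imports "HOL-Analysis.Analysis"
begin

text \<open>Real Hilbert spaces are types of class \<open>{real_inner, complete_space}\<close>, Banach spaces are types of
  class \<open>banach\<close>; the dual of \<open>'a\<close> is \<open>'a \<Rightarrow>\<^sub>L real\<close>.\<close>

definition weak_topology :: "'a::real_normed_vector topology" where
  "weak_topology = pullback_topology UNIV (\<lambda>x (\<phi> :: 'a \<Rightarrow>\<^sub>L real). blinfun_apply \<phi> x) euclidean"

definition weakly_converges :: "(nat \<Rightarrow> 'a::real_normed_vector) \<Rightarrow> 'a \<Rightarrow> bool"  (infix "\<rightharpoonup>" 55) where
  "x \<rightharpoonup> l \<longleftrightarrow> (\<forall>\<phi> :: 'a \<Rightarrow>\<^sub>L real. (\<lambda>n. blinfun_apply \<phi> (x n)) \<longlonglongrightarrow> blinfun_apply \<phi> l)"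

lemma weakly_converges_iff_limitin:
  "x \<rightharpoonup> l \<longleftrightarrow> limitin weak_topology x l sequentially"
proof -
  have 1: "limitin weak_topology x l sequentially \<longleftrightarrow>
      limitin euclidean (\<lambda>n (\<phi> :: 'a \<Rightarrow>\<^sub>L real). blinfun_apply \<phi> (x n)) (\<lambda>\<phi>. blinfun_apply \<phi> l) sequentially"
    by (auto simp: limitin_def weak_topology_def topspace_pullback_topology openin_pullback_topology)
  show ?thesis
    unfolding 1 euclidean_product_topology[symmetric] limitin_componentwise
    by (simp add: weakly_converges_def)
qed

definition reflexive_space :: "'a::real_normed_vector itself \<Rightarrow> bool" where
  "reflexive_space _ \<longleftrightarrow>
    (\<forall>\<Psi> :: ('a \<Rightarrow>\<^sub>L real) \<Rightarrow>\<^sub>L real. \<exists>x :: 'a. \<forall>\<phi>. blinfun_apply \<Psi> \<phi> = blinfun_apply \<phi> x)"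

definition strongly_monotone_Lipschitz :: "real \<Rightarrow> real \<Rightarrow> ('a::real_inner \<Rightarrow> 'a) \<Rightarrow> bool" where
  "strongly_monotone_Lipschitz m L A \<longleftrightarrow> m > 0 \<and> L > 0 \<and>
    (\<forall>u v. (A u - A v) \<bullet> (u - v) \<ge> m * (norm (u - v))\<^sup>2) \<and>
    (\<forall>u v. norm (A u - A v) \<le> L * norm (u - v))"

text \<open>Elements of \<open>C(\<real>\<^sub>+; X)\<close> are represented by functions on all of \<open>real\<close> that are continuous on
  \<open>{0..}\<close>; their values at negative arguments are irrelevant. A history-dependent operator does not
  depend on the representative, since the integral below vanishes for functions that agree on \<open>{0..}\<close>.\<close>

definition history_dependent ::
    "(nat \<Rightarrow> real) \<Rightarrow> ((real \<Rightarrow> 'a::real_normed_vector) \<Rightarrow> real \<Rightarrow> 'a) \<Rightarrow> bool" where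
  "history_dependent s S \<longleftrightarrow> (\<forall>m. s m \<ge> 0) \<and>
    (\<forall>u. continuous_on {0..} u \<longrightarrow> continuous_on {0..} (S u)) \<and>
    (\<forall>m u1 u2. continuous_on {0..} u1 \<longrightarrow> continuous_on {0..} u2 \<longrightarrow>
      (\<forall>t\<in>{0..real m}. norm (S u1 t - S u2 t) \<le> s m * integral {0..t} (\<lambda>r. norm (u1 r - u2 r))))"

text \<open>The infimum and supremum are taken in the extended reals, where \<open>INF\<close> over the empty set is
  \<open>\<infinity>\<close> and \<open>SUP\<close> over the empty set is \<open>-\<infinity>\<close>.\<close>

definition inf_sup_bilinear_form ::
    "real \<Rightarrow> real \<Rightarrow> ('a::real_normed_vector \<Rightarrow> 'b::real_normed_vector \<Rightarrow> real) \<Rightarrow> bool" where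
  "inf_sup_bilinear_form M \<alpha> b \<longleftrightarrow> M > 0 \<and> \<alpha> > 0 \<and> bilinear b \<and>
    (\<forall>v \<mu>. \<bar>b v \<mu>\<bar> \<le> M * norm v * norm \<mu>) \<and>
    (INF \<mu>\<in>{\<mu>. \<mu> \<noteq> 0}. SUP v\<in>{v. v \<noteq> 0}. ereal (b v \<mu> / (norm v * norm \<mu>))) \<ge> ereal \<alpha>"

definition mixed_solution ::
    "('x::real_inner \<Rightarrow> 'x) \<Rightarrow> ((real \<Rightarrow> 'x) \<Rightarrow> real \<Rightarrow> 'x) \<Rightarrow> ('x \<Rightarrow> 'y::real_inner \<Rightarrow> real) \<Rightarrow> 'y set \<Rightarrow>
     ('x \<Rightarrow> 'z::real_inner) \<Rightarrow> (real \<Rightarrow> 'z) \<Rightarrow> (real \<Rightarrow> 'x) \<Rightarrow> (real \<Rightarrow> 'x) \<Rightarrow> (real \<Rightarrow> 'y) \<Rightarrow> bool" where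
  "mixed_solution A S b \<Lambda> \<pi> f h u l \<longleftrightarrow>
    continuous_on {0..} (\<lambda>t. (u t, l t)) \<and> (\<forall>t\<ge>0. l t \<in> \<Lambda>) \<and>
    (\<forall>t\<ge>0.
      (\<forall>v. A (u t) \<bullet> v + S u t \<bullet> v + b v (l t) = f t \<bullet> \<pi> v) \<and>
      (\<forall>\<mu>\<in>\<Lambda>. b (u t) (\<mu> - l t) \<le> b (h t) (\<mu> - l t)))"

definition Mosco_converges :: "(nat \<Rightarrow> 'a::real_normed_vector set) \<Rightarrow> 'a set \<Rightarrow> bool" where
  "Mosco_converges K K0 \<longleftrightarrow>
    (\<forall>\<mu>\<in>K0. \<exists>m. (\<forall>n. m n \<in> K n) \<and> m \<longlonglongrightarrow> \<mu>) \<and>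
    (\<forall>m \<mu>. (\<forall>n. m n \<in> K n) \<longrightarrow> m \<rightharpoonup> \<mu> \<longrightarrow> \<mu> \<in> K0)"

end

(* A minimizing sequence of parameters is bounded, by coercivity or by boundedness of U, so by
   reflexivity a subsequence converges weakly to some p in U; lower semicontinuity of the cost then
   reduces the claim to the convergence of u_{p_n}(t) strongly and of l_{p_n}(t) weakly, along a
   subsequence, to u_p(t) and l_p(t).

   For the convergence, put d_n = |u_{p_n} - u_p|. At a fixed time, testing the equation with
   u_{p_n} - u_p and passing to weak limits shows limsup (d_n(t) - C int_0^t d_n) <= 0, where
   C is the history constant divided by the monotonicity constant. Gronwall's inequality and dominated
   convergence turn this pointwise statement into d_n(t) -> 0. A weak limit of the multipliers is then
   identified by the limit equation, since the inf-sup condition makes the multiplier unique.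

   Weak sequential compactness rests on a Hahn-Banach extension argument: a linear functional dominated
   by phi |-> limsup phi(w_n) on the dual is, by reflexivity, evaluation at a point. *)
theory Submission
  imports Defs "HOL-Complex_Analysis.Great_Picard"
begin

section \<open>Hahn--Banach theorem\<close>

text \<open>The obstacle is the memory term. Weakly convergent subsequences of the solutions at time
  t depend on t, so their limits cannot be assembled into a function on which the history operator
  could act, and nonlinear operators do not pass to weak limits. Both kinds of operators are
  therefore compared with their values at the fixed limit solution, which converge strongly; the
  remaining difference in A is absorbed by strong monotonicity, the one in S by the integral of d_n.
  What is left is a claim about real numbers, which may be checked along subsequences and so holds
  for the full sequence at each t. The pairings survive weak limits because \<open>\<pi>\<close>
  turns weak into strong convergence and because the condition on the forms, used for both signs,
  makes them continuous for weak convergence in both arguments.\<close>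

definition sublinear :: "('a::real_vector \<Rightarrow> real) \<Rightarrow> bool" where
  "sublinear q \<longleftrightarrow> (\<forall>x y. q (x + y) \<le> q x + q y) \<and> (\<forall>c\<ge>0. \<forall>x. q (c *\<^sub>R x) = c * q x)"

lemma sublinear_add: "sublinear q \<Longrightarrow> q (x + y) \<le> q x + q y"
  and sublinear_scaleR: "sublinear q \<Longrightarrow> c \<ge> 0 \<Longrightarrow> q (c *\<^sub>R x) = c * q x"
  by (auto simp: sublinear_def)

lemma sublinear_0: "sublinear q \<Longrightarrow> q 0 = 0"
  using sublinear_scaleR[of q 0 0] by simp

lemma sublinear_ge_minus: "sublinear q \<Longrightarrow> - q (- x) \<le> q x"
  using sublinear_add[of q x "- x"] by (simp add: sublinear_0)

text \<open>Applying the scaling inequality with \<open>inverse c\<close> gives the reverse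
  inequality, so only one direction has to be checked for the infima built below.\<close>

lemma sublinearI_scaleR_le:
  assumes add: "\<And>x y. q (x + y) \<le> q x + q y"
    and sc: "\<And>c x. c > 0 \<Longrightarrow> q (c *\<^sub>R x) \<le> c * q x" and "q 0 = 0"
  shows "sublinear q"
  unfolding sublinear_def
proof (intro conjI allI impI)
  fix c :: real and x assume "c \<ge> 0"
  show "q (c *\<^sub>R x) = c * q x"
  proof (cases "c = 0")
    case False
    with \<open>c \<ge> 0\<close> have c: "c > 0" by simp
    have "q (inverse c *\<^sub>R (c *\<^sub>R x)) \<le> inverse c * q (c *\<^sub>R x)"
      using c by (intro sc) simp
    then have "c * q x \<le> q (c *\<^sub>R x)"
      using c by (simp add: field_simps)
    with sc[OF c, of x] show ?thesis by simp
  qed (simp add: \<open>q 0 = 0\<close>)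
qed (rule add)

text \<open>Lowering a sublinear functional along a ray makes it linear there.\<close>

lemma sublinear_lower_along_ray:
  fixes q :: "'a::real_vector \<Rightarrow> real"
  assumes q: "sublinear q"
  obtains q' where "sublinear q'" "\<And>y. q' y \<le> q y" "q' (- x) \<le> - q x"
proof -
  \<comment> \<open>Any sublinear r below q with \<open>r (- x) \<le> - q x\<close> satisfies r(y)
    \<le> r(y + t x) + t r(-x) \<le> q(y + t x) - t q(x) for every t \<ge> 0. The infimum of these
    bounds is thus the largest functional with the required properties.\<close>
  define S where "S y = {q (y + t *\<^sub>R x) - t * q x | t. t \<ge> 0}" for y
  define q' where "q' y = Inf (S y)" for y
  have low: "- q (- y) \<le> q (y + t *\<^sub>R x) - t * q x" if "t \<ge> 0" for t y
    using sublinear_add[OF q, of "y + t *\<^sub>R x" "- y"] sublinear_scaleR[OF q that, of x] by simp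
  have ne: "S y \<noteq> {}" for y
    by (auto simp: S_def)
  have bdd: "bdd_below (S y)" for y
    using low by (auto simp: S_def intro!: bdd_belowI[of _ "- q (- y)"])
  have le: "q' y \<le> q (y + t *\<^sub>R x) - t * q x" if "t \<ge> 0" for t y
    unfolding q'_def using that by (intro cInf_lower bdd) (auto simp: S_def)
  have ge: "c \<le> q' y" if "\<And>t. t \<ge> 0 \<Longrightarrow> c \<le> q (y + t *\<^sub>R x) - t * q x" for c y
    unfolding q'_def using that by (intro cInf_greatest ne) (auto simp: S_def)
  have "q' (y + z) \<le> q' y + q' z" for y z
  proof -
    have *: "q' (y + z) \<le> (q (y + t *\<^sub>R x) - t * q x) + (q (z + r *\<^sub>R x) - r * q x)"
      if "t \<ge> 0" "r \<ge> 0" for t r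
      using le[of "t + r" "y + z"] sublinear_add[OF q, of "y + t *\<^sub>R x" "z + r *\<^sub>R x"] that
      by (simp add: algebra_simps)
    have "q' (y + z) - (q (y + t *\<^sub>R x) - t * q x) \<le> q' z" if "t \<ge> 0" for t
      using *[OF that] by (intro ge) (simp add: algebra_simps)
    then have "q' (y + z) - q' z \<le> q' y"
      by (intro ge) (simp add: algebra_simps)
    then show ?thesis by simp
  qed
  moreover have "q' (c *\<^sub>R y) \<le> c * q' y" if c: "c > 0" for c y
  proof -
    have "q' (c *\<^sub>R y) / c \<le> q (y + t *\<^sub>R x) - t * q x" if "t \<ge> 0" for t
      using le[of "c * t" "c *\<^sub>R y"] sublinear_scaleR[OF q, of c "y + t *\<^sub>R x"] that c
      by (simp add: field_simps)
    then have "q' (c *\<^sub>R y) / c \<le> q' y"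
      by (rule ge)
    then show ?thesis using c by (simp add: field_simps)
  qed
  moreover have "q' 0 = 0"
    using le[of 0 0] low[of _ 0] ge[of 0 0] by (simp add: sublinear_0[OF q])
  ultimately have "sublinear q'"
    by (rule sublinearI_scaleR_le)
  moreover have "q' y \<le> q y" for y
    using le[of 0 y] by simp
  moreover have "q' (- x) \<le> - q x"
    using le[of 1 "- x"] by (simp add: sublinear_0[OF q])
  ultimately show ?thesis by (rule that)
qed

text \<open>Zorn's lemma for the reversed pointwise order, with the pointwise infimum of a chain as
  its bound. The infimum is finite because every sublinear q below p satisfies
  \<open>- p (- x) \<le> q x\<close>.\<close>

lemma minimal_sublinear_exists:
  fixes p :: "'a::real_vector \<Rightarrow> real"
  assumes p: "sublinear p"
  obtains q where "sublinear q" "\<And>x. q x \<le> p x"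
    "\<And>q'. sublinear q' \<Longrightarrow> (\<And>x. q' x \<le> q x) \<Longrightarrow> q' = q"
proof -
  define A where "A = {q. sublinear q \<and> q \<le> p}"
  have "\<exists>m\<in>A. \<forall>a\<in>A. m \<ge> a \<longrightarrow> a = m"
  proof (rule predicate_Zorn)
    show "partial_order_on A (relation_of (\<ge>) A)"
      by (rule partial_order_on_relation_ofI) auto
    fix C assume C: "C \<in> Chains (relation_of (\<ge>) A)"
    then have CA: "C \<subseteq> A"
      by (auto simp: Chains_def relation_of_def)
    have chain: "a \<le> b \<or> b \<le> a" if "a \<in> C" "b \<in> C" for a b
      using C that by (auto simp: Chains_def relation_of_def)
    show "\<exists>u\<in>A. \<forall>a\<in>C. a \<ge> u"
    proof (cases "C = {}")
      case True
      then show ?thesis using p by (auto simp: A_def)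
    next
      case False
      have sub: "sublinear q" "q x \<le> p x" if "q \<in> C" for q x
        using that CA by (auto simp: A_def le_fun_def)
      define u where "u x = (INF q\<in>C. q x)" for x
      have low: "- p (- x) \<le> q x" if "q \<in> C" for q x
        using sub(2)[OF that, of "- x"] sublinear_ge_minus[OF sub(1)[OF that], of x] by simp
      have bdd: "bdd_below ((\<lambda>q. q x) ` C)" for x
        using low by (auto intro!: bdd_belowI[of _ "- p (- x)"])
      have le: "u x \<le> q x" if "q \<in> C" for q x
        unfolding u_def using bdd that by (rule cINF_lower)
      have ge: "c \<le> u x" if "\<And>q. q \<in> C \<Longrightarrow> c \<le> q x" for c x
        unfolding u_def using False that by (rule cINF_greatest)
      have "u (x + y) \<le> u x + u y" for x y
      proof -
        \<comment> \<open>The smaller of two members of the chain is subadditive and lies below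
          both; this is where totality of the order enters.\<close>
        have *: "u (x + y) \<le> q x + r y" if "q \<in> C" "r \<in> C" for q r
        proof -
          from chain[OF that] show ?thesis
          proof
            assume "q \<le> r"
            then show ?thesis
              using le[OF that(1), of "x + y"] sublinear_add[OF sub(1)[OF that(1)], of x y]
              by (auto simp: le_fun_def intro: order_trans add_left_mono)
          next
            assume "r \<le> q"
            then show ?thesis
              using le[OF that(2), of "x + y"] sublinear_add[OF sub(1)[OF that(2)], of x y]
              by (auto simp: le_fun_def intro: order_trans add_right_mono)
          qed
        qed
        have "u (x + y) - q x \<le> u y" if "q \<in> C" for q
          using *[OF that] by (intro ge) (simp add: algebra_simps)
        then have "u (x + y) - u y \<le> u x"
          by (intro ge) (simp add: algebra_simps)
        then show ?thesis by simp
      qed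
      moreover have "u (c *\<^sub>R x) \<le> c * u x" if c: "c > 0" for c x
      proof -
        have "u (c *\<^sub>R x) / c \<le> q x" if "q \<in> C" for q
          using le[OF that, of "c *\<^sub>R x"] sublinear_scaleR[OF sub(1)[OF that], of c x] c
          by (simp add: field_simps)
        then have "u (c *\<^sub>R x) / c \<le> u x" by (rule ge)
        then show ?thesis using c by (simp add: field_simps)
      qed
      moreover have "u 0 = 0"
        using False le[of _ 0] ge[of 0 0] sublinear_0[OF sub(1)]
        by (metis all_not_in_conv order.eq_iff)
      ultimately have "sublinear u"
        by (rule sublinearI_scaleR_le)
      moreover have "u \<le> p"
        using False le sub(2) by (metis all_not_in_conv le_funI order_trans)
      ultimately show ?thesis
        using le by (auto simp: A_def le_fun_def)
    qed
  qed
  then obtain m where m: "m \<in> A" "\<And>a. a \<in> A \<Longrightarrow> a \<le> m \<Longrightarrow> a = m" by blast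
  show ?thesis
  proof
    show "sublinear m" "m x \<le> p x" for x
      using m(1) by (auto simp: A_def le_fun_def)
    show "q' = m" if "sublinear q'" "\<And>x. q' x \<le> m x" for q'
      using m(1) that by (intro m(2)) (auto simp: A_def le_fun_def intro: order_trans)
  qed
qed

text \<open>A minimal sublinear functional cannot be lowered along any ray, so it is odd, and an odd
  sublinear functional is linear. Lowering p along the ray of \<open>x0\<close> beforehand bounds
  the value at \<open>- x0\<close> by \<open>- p x0\<close>, which forces equality at
  \<open>x0\<close>.\<close>

theorem Hahn_Banach_supporting:
  fixes p :: "'a::real_vector \<Rightarrow> real"
  assumes p: "sublinear p"
  obtains g where "linear g" "\<And>x. g x \<le> p x" "g x0 = p x0"
proof -
  obtain p' where p': "sublinear p'" "\<And>y. p' y \<le> p y" "p' (- x0) \<le> - p x0"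
    using sublinear_lower_along_ray[OF p] by metis
  obtain q where q: "sublinear q" "\<And>x. q x \<le> p' x"
    and min: "\<And>q'. sublinear q' \<Longrightarrow> (\<And>x. q' x \<le> q x) \<Longrightarrow> q' = q"
    using minimal_sublinear_exists[OF p'(1)] by metis
  have odd: "q (- x) = - q x" for x
  proof -
    obtain q' where "sublinear q'" "\<And>y. q' y \<le> q y" "q' (- x) \<le> - q x"
      using sublinear_lower_along_ray[OF q(1)] by metis
    then show ?thesis
      using min[of q'] sublinear_ge_minus[OF q(1), of x] by simp
  qed
  have "linear q"
  proof (rule linearI)
    show "q (x + y) = q x + q y" for x y
      using sublinear_add[OF q(1), of x y] sublinear_add[OF q(1), of "- x" "- y"] odd[of "x + y"]
      by (simp add: odd)
    show "q (c *\<^sub>R x) = c *\<^sub>R q x" for c x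
      using sublinear_scaleR[OF q(1), of c x] sublinear_scaleR[OF q(1), of "- c" x] odd[of "c *\<^sub>R x"]
      by (cases "c \<ge> 0") auto
  qed
  moreover have "q x \<le> p x" for x
    using q(2) p'(2) order_trans by blast
  moreover have "q x0 = p x0"
    using q(2)[of "- x0"] p'(3) odd[of x0] calculation(2)[of x0] by simp
  ultimately show ?thesis by (rule that)
qed

section \<open>Norming functionals and functionals vanishing on a closed subspace\<close>

lemma Hahn_Banach_norming:
  fixes x :: "'a::real_normed_vector"
  obtains \<phi> :: "'a \<Rightarrow>\<^sub>L real" where "norm \<phi> \<le> 1" "\<phi> x = norm x"
proof -
  have "sublinear (norm :: 'a \<Rightarrow> real)"
    by (auto simp: sublinear_def norm_triangle_ineq)
  then obtain g where g: "linear g" "\<And>y. g y \<le> norm y" "g x = norm x"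
    using Hahn_Banach_supporting by metis
  have abs: "norm (g y) \<le> norm y * 1" for y
    using g(2)[of y] g(2)[of "- y"] by (simp add: linear_neg[OF g(1)] abs_le_iff)
  then have bl: "bounded_linear g"
    using g(1) by (intro bounded_linear_intro[where K=1]) (auto simp: linear_add linear_scale)
  show ?thesis
  proof
    show "norm (Blinfun g) \<le> 1"
      using abs bl by (intro norm_blinfun_bound) (auto simp: bounded_linear_Blinfun_apply)
    show "Blinfun g x = norm x"
      using g(3) bl by (simp add: bounded_linear_Blinfun_apply)
  qed
qed

text \<open>The distance to M is sublinear. A linear functional below it is at most 0 at y and at -y
  for y in M, hence vanishes there, while its value at x can be made the distance of x from M, which
  is positive because M is closed.\<close>

lemma Hahn_Banach_closed_subspace:
  fixes M :: "'a::real_normed_vector set"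
  assumes M: "subspace M" "closed M" and x: "x \<notin> M"
  obtains \<phi> :: "'a \<Rightarrow>\<^sub>L real" where "\<And>y. y \<in> M \<Longrightarrow> \<phi> y = 0" "\<phi> x \<noteq> 0"
proof -
  have ne: "M \<noteq> {}" using subspace_0[OF M(1)] by auto
  have approx: "\<exists>a\<in>M. dist y a < infdist y M + e" if "e > 0" for y and e :: real
    using cInf_lessD[of "dist y ` M" "infdist y M + e"] ne that by (auto simp: infdist_notempty)
  have "sublinear (\<lambda>y. infdist y M)"
  proof (rule sublinearI_scaleR_le)
    show "infdist (y + z) M \<le> infdist y M + infdist z M" for y z
    proof (rule field_le_epsilon)
      fix e :: real assume "e > 0"
      then obtain a c where a: "a \<in> M" "dist y a < infdist y M + e/2"
        and c: "c \<in> M" "dist z c < infdist z M + e/2"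
        using approx[of "e/2" y] approx[of "e/2" z] by auto
      have "infdist (y + z) M \<le> dist (y + z) (a + c)"
        using a c M(1) by (intro infdist_le) (auto simp: subspace_add)
      also have "\<dots> \<le> dist y a + dist z c"
        by (rule dist_triangle_add)
      finally show "infdist (y + z) M \<le> infdist y M + infdist z M + e"
        using a c by simp
    qed
    show "infdist (c *\<^sub>R y) M \<le> c * infdist y M" if c: "c > 0" for c :: real and y
    proof (rule field_le_epsilon)
      fix e :: real assume "e > 0"
      then obtain a where a: "a \<in> M" "dist y a < infdist y M + e/c"
        using approx[of "e/c" y] c \<open>e > 0\<close> by auto
      have "infdist (c *\<^sub>R y) M \<le> dist (c *\<^sub>R y) (c *\<^sub>R a)"
        using a M(1) by (intro infdist_le) (auto simp: subspace_scale)
      also have "\<dots> = c * dist y a"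
        using c by (simp add: dist_norm flip: scaleR_diff_right)
      finally show "infdist (c *\<^sub>R y) M \<le> c * infdist y M + e"
        using a c by (simp add: field_simps)
    qed
    show "infdist 0 M = 0"
      using subspace_0[OF M(1)] by simp
  qed
  then obtain g where g: "linear g" "\<And>y. g y \<le> infdist y M" "g x = infdist x M"
    using Hahn_Banach_supporting by metis
  have le: "g y \<le> norm y" for y
    using g(2)[of y] infdist_le[OF subspace_0[OF M(1)], of y] by simp
  have "norm (g y) \<le> norm y * 1" for y
    using le[of y] le[of "- y"] by (simp add: linear_neg[OF g(1)] abs_le_iff)
  then have bl: "bounded_linear g"
    using g(1) by (intro bounded_linear_intro[where K=1]) (auto simp: linear_add linear_scale)
  show ?thesis
  proof
    show "Blinfun g y = 0" if "y \<in> M" for y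
      using g(2)[of y] g(2)[of "- y"] that subspace_neg[OF M(1) that] bl
      by (simp add: bounded_linear_Blinfun_apply linear_neg[OF g(1)])
    show "Blinfun g x \<noteq> 0"
      using g(3) x in_closed_iff_infdist_zero[OF M(2) ne] bl
      by (simp add: bounded_linear_Blinfun_apply)
  qed
qed

section \<open>Weak sequential compactness in reflexive spaces\<close>

text \<open>The functional obtained from Hahn-Banach acts as a Banach limit: lying below the limsup
  at \<open>\<phi>\<close> and at \<open>- \<phi>\<close>, it must return the limit whenever that
  exists. Reflexivity makes one point serve all functionals at once.\<close>

lemma reflexive_generalized_limit:
  fixes w :: "nat \<Rightarrow> 'a::real_normed_vector"
  assumes refl: "reflexive_space TYPE('a)" and w: "\<And>n. norm (w n) \<le> C"
  obtains x where "\<And>(\<phi> :: 'a \<Rightarrow>\<^sub>L real) c. (\<lambda>n. blinfun_apply \<phi> (w n)) \<longlonglongrightarrow> c \<Longrightarrow> blinfun_apply \<phi> x = c"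
proof -
  define P where "P \<phi> = limsup (\<lambda>n. ereal (blinfun_apply \<phi> (w n)))" for \<phi> :: "'a \<Rightarrow>\<^sub>L real"
  define p where "p \<phi> = real_of_ereal (P \<phi>)" for \<phi>
  have abs: "\<bar>\<phi> (w n)\<bar> \<le> C * norm \<phi>" for \<phi> :: "'a \<Rightarrow>\<^sub>L real" and n
    using norm_blinfun[of \<phi> "w n"] mult_right_mono[OF w[of n] norm_ge_zero[of \<phi>]]
    by (simp add: mult.commute)
  have up: "P \<phi> \<le> ereal (C * norm \<phi>)" for \<phi>
    unfolding P_def using abs[of \<phi>] by (intro Limsup_bounded) (auto simp: abs_le_iff)
  have lo: "ereal (- (C * norm \<phi>)) \<le> P \<phi>" for \<phi>
  proof -
    have "ereal (- (C * norm \<phi>)) \<le> liminf (\<lambda>n. ereal (\<phi> (w n)))"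
      using abs[of \<phi>] by (intro Liminf_bounded) (auto simp: abs_le_iff minus_le_iff)
    then show ?thesis
      unfolding P_def using Liminf_le_Limsup[of sequentially "\<lambda>n. ereal (\<phi> (w n))"]
      by (simp add: order_trans)
  qed
  \<comment> \<open>The two bounds exclude infinite values, so p loses no information about
    P.\<close>
  have P: "P \<phi> = ereal (p \<phi>)" for \<phi>
    using up[of \<phi>] lo[of \<phi>] unfolding p_def by (cases "P \<phi>") auto
  have le: "p \<phi> \<le> C * norm \<phi>" for \<phi>
    using up[of \<phi>] by (simp add: P)
  have "sublinear p"
    unfolding sublinear_def
  proof (intro conjI allI impI)
    fix \<phi> \<psi>
    have "P (\<phi> + \<psi>) \<le> P \<phi> + P \<psi>"
      unfolding P_def
      using ereal_limsup_add_mono[of "\<lambda>n. ereal (\<phi> (w n))" "\<lambda>n. ereal (\<psi> (w n))"]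
      by (simp add: blinfun.add_left)
    then show "p (\<phi> + \<psi>) \<le> p \<phi> + p \<psi>"
      by (simp add: P)
  next
    fix c :: real and \<phi> assume "c \<ge> 0"
    then have "P (c *\<^sub>R \<phi>) = ereal c * P \<phi>"
      unfolding P_def using limsup_ereal_mult_left[of c "\<lambda>n. ereal (\<phi> (w n))"]
      by (simp add: blinfun.scaleR_left)
    then show "p (c *\<^sub>R \<phi>) = c * p \<phi>"
      by (simp add: P)
  qed
  then obtain g where g: "linear g" "\<And>\<phi>. g \<phi> \<le> p \<phi>"
    using Hahn_Banach_supporting by metis
  have "norm (g \<phi>) \<le> norm \<phi> * C" for \<phi>
    using g(2)[of \<phi>] g(2)[of "- \<phi>"] le[of \<phi>] le[of "- \<phi>"]
    by (simp add: linear_neg[OF g(1)] abs_le_iff mult.commute)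
  then have bl: "bounded_linear g"
    using g(1) by (intro bounded_linear_intro[where K=C]) (auto simp: linear_add linear_scale)
  obtain x where x: "\<And>\<phi>. Blinfun g \<phi> = blinfun_apply \<phi> x"
    using refl unfolding reflexive_space_def by blast
  show ?thesis
  proof (rule that)
    fix \<phi> :: "'a \<Rightarrow>\<^sub>L real" and c assume lim: "(\<lambda>n. \<phi> (w n)) \<longlonglongrightarrow> c"
    have "P \<phi> = ereal c"
      unfolding P_def using lim by (intro lim_imp_Limsup) auto
    moreover have "P (- \<phi>) = ereal (- c)"
      unfolding P_def using tendsto_minus[OF lim]
      by (intro lim_imp_Limsup) (auto simp: blinfun.minus_left)
    ultimately have "p \<phi> = c" "p (- \<phi>) = - c"
      by (simp_all add: P)
    then have "g \<phi> = c"
      using g(2)[of \<phi>] g(2)[of "- \<phi>"] by (simp add: linear_neg[OF g(1)])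
    then show "\<phi> x = c"
      using x[of \<phi>] bl by (simp add: bounded_linear_Blinfun_apply)
  qed
qed

section \<open>Separable closed spans and extraction of weakly convergent subsequences\<close>

lemma subspace_closure:
  fixes S :: "'a::real_normed_vector set"
  assumes S: "subspace S"
  shows "subspace (closure S)"
  unfolding subspace_def
proof (intro conjI ballI allI)
  show "0 \<in> closure S"
    using subspace_0[OF S] closure_subset by blast
  fix x assume "x \<in> closure S"
  then obtain f where f: "\<And>n. f n \<in> S" "f \<longlonglongrightarrow> x"
    unfolding closure_sequential by blast
  show "c *\<^sub>R x \<in> closure S" for c
    unfolding closure_sequential
    using f S by (intro exI[of _ "\<lambda>n. c *\<^sub>R f n"]) (auto intro!: tendsto_intros subspace_scale)
  fix y assume "y \<in> closure S"
  then obtain g where g: "\<And>n. g n \<in> S" "g \<longlonglongrightarrow> y"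
    unfolding closure_sequential by blast
  show "x + y \<in> closure S"
    unfolding closure_sequential
    using f g S by (intro exI[of _ "\<lambda>n. f n + g n"]) (auto intro!: tendsto_intros subspace_add)
qed

lemma closure_span_range_separable:
  fixes w :: "nat \<Rightarrow> 'a::real_normed_vector"
  obtains D where "countable D" "closure (span (range w)) \<subseteq> closure D"
proof
  \<comment> \<open>Extensional functions on \<open>{..<n}\<close> carry only finitely many rational
    coefficients, which keeps the index set countable; the functions
    \<open>nat \<Rightarrow> rat\<close> without this restriction are uncountably many.\<close>
  define D where "D = (\<Union>n. (\<lambda>c::nat \<Rightarrow> rat. \<Sum>i<n. real_of_rat (c i) *\<^sub>R w i) ` Pi\<^sub>E {..<n} (\<lambda>_. UNIV))"
  show "countable D"
    unfolding D_def by (intro countable_UN countable_image countable_PiE) auto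
  have comb: "\<exists>n a. x = (\<Sum>i<n. a i *\<^sub>R w i)" if "x \<in> span (range w)" for x
    using that
  proof (induction rule: span_induct_alt)
    case base
    show ?case by (intro exI[of _ 0]) simp
  next
    case (step c x y)
    then obtain n a k where y: "y = (\<Sum>i<n. a i *\<^sub>R w i)" and x: "x = w k" by blast
    define N where "N = max n (Suc k)"
    have "y = (\<Sum>i<N. (if i < n then a i else 0) *\<^sub>R w i)"
      unfolding y by (rule sum.mono_neutral_cong_left) (auto simp: N_def)
    moreover have "c *\<^sub>R x = (\<Sum>i<N. (if i = k then c else 0) *\<^sub>R w i)"
    proof -
      have "k < N" by (simp add: N_def)
      then show ?thesis
        by (simp add: x if_distrib[of "\<lambda>r. r *\<^sub>R _"] sum.delta cong: if_cong)
    qed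
    ultimately have "c *\<^sub>R x + y = (\<Sum>i<N. ((if i = k then c else 0) + (if i < n then a i else 0)) *\<^sub>R w i)"
      by (simp only: scaleR_add_left sum.distrib)
    then show ?case by (intro exI)
  qed
  have "span (range w) \<subseteq> closure D"
  proof
    fix x assume "x \<in> span (range w)"
    then obtain n a where x: "x = (\<Sum>i<n. a i *\<^sub>R w i)" using comb by blast
    have "\<exists>q::rat. a i < real_of_rat q \<and> real_of_rat q < a i + inverse (real (Suc k))" for i k
      by (intro of_rat_dense) simp
    then obtain q where q: "\<And>i k. a i < real_of_rat (q i k)"
        "\<And>i k. real_of_rat (q i k) < a i + inverse (real (Suc k))"
      by metis
    have "(\<lambda>k. real_of_rat (q i k)) \<longlonglongrightarrow> a i" for i
    proof (rule tendsto_sandwich[of "\<lambda>_. a i"])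
      show "(\<lambda>k. a i + inverse (real (Suc k))) \<longlonglongrightarrow> a i"
        using LIMSEQ_inverse_real_of_nat_add[of "a i"] .
    qed (use q in \<open>auto intro!: always_eventually less_imp_le simp del: of_nat_Suc\<close>)
    then have "(\<lambda>k. \<Sum>i<n. real_of_rat (q i k) *\<^sub>R w i) \<longlonglongrightarrow> x"
      unfolding x by (intro tendsto_intros)
    moreover have "(\<Sum>i<n. real_of_rat (q i k) *\<^sub>R w i) \<in> D" for k
      unfolding D_def
      by (rule UN_I[of n], simp, rule image_eqI[of _ _ "restrict (\<lambda>i. q i k) {..<n}"]) auto
    ultimately show "x \<in> closure D"
      unfolding closure_sequential
      by (intro exI[of _ "\<lambda>k. \<Sum>i<n. real_of_rat (q i k) *\<^sub>R w i"]) auto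
  qed
  then show "closure (span (range w)) \<subseteq> closure D"
    by (simp add: closure_minimal)
qed

text \<open>Turns failure of convergence into a subsequence with a definite wrong limit, from which
  further subsequences can be drawn in proofs by contradiction.\<close>

lemma bounded_seq_limit_point_real:
  fixes f :: "nat \<Rightarrow> real"
  assumes b: "\<And>n. \<bar>f n\<bar> \<le> C" and not: "\<not> f \<longlonglongrightarrow> l"
  obtains r c where "strict_mono (r :: nat \<Rightarrow> nat)" "(f \<circ> r) \<longlonglongrightarrow> c" "c \<noteq> l"
proof -
  have "\<not> (\<forall>e>0. eventually (\<lambda>n. dist (f n) l < e) sequentially)"
    using not by (simp add: tendsto_iff)
  then obtain e where e: "e > 0" "\<exists>\<^sub>F n in sequentially. \<not> dist (f n) l < e"
    by (auto simp: not_eventually)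
  have "infinite {n. \<not> dist (f n) l < e}"
    using e(2) by (simp add: frequently_cofinite[symmetric] cofinite_eq_sequentially)
  then obtain r1 :: "nat \<Rightarrow> nat" where r1: "strict_mono r1" "\<And>n. e \<le> dist (f (r1 n)) l"
    using infinite_enumerate[of "{n. \<not> dist (f n) l < e}"] by (auto simp: not_less)
  have "bounded (range (f \<circ> r1))"
    using b by (auto simp: bounded_iff)
  then obtain c r2 where r2: "strict_mono r2" "((f \<circ> r1) \<circ> r2) \<longlonglongrightarrow> c"
    using bounded_imp_convergent_subsequence by blast
  have "e \<le> dist c l"
  proof (rule tendsto_lowerbound)
    show "(\<lambda>n. dist ((f \<circ> r1 \<circ> r2) n) l) \<longlonglongrightarrow> dist c l"
      by (intro tendsto_intros r2)
  qed (use r1 in auto)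
  then show ?thesis
    using r1 r2 e(1) by (intro that[of "r1 \<circ> r2" c]) (auto simp: strict_mono_o o_assoc)
qed

text \<open>The norming functionals of a countable dense subset of the closed span \<open>M\<close> of the sequence
  separate the points of \<open>M\<close>. Along a subsequence on which they all converge, every generalized limit
  of every further subsequence therefore is the same point, and this is the weak limit.\<close>

theorem reflexive_weakly_convergent_subsequence:
  fixes w :: "nat \<Rightarrow> 'a::real_normed_vector"
  assumes refl: "reflexive_space TYPE('a)" and w: "\<And>n. norm (w n) \<le> C"
  obtains r x where "strict_mono (r :: nat \<Rightarrow> nat)" "(w \<circ> r) \<rightharpoonup> x"
proof -
  define M where "M = closure (span (range w))"
  have M: "subspace M" "closed M" and wM: "w n \<in> M" for n
    unfolding M_def
    by (auto intro: subspace_closure closure_subset[THEN subsetD] span_base)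
  obtain D where D: "countable D" "M \<subseteq> closure D"
    unfolding M_def by (rule closure_span_range_separable)
  have "\<forall>d. \<exists>\<phi> :: 'a \<Rightarrow>\<^sub>L real. norm \<phi> \<le> 1 \<and> blinfun_apply \<phi> d = norm d"
    using Hahn_Banach_norming by metis
  then obtain \<Phi> :: "'a \<Rightarrow> 'a \<Rightarrow>\<^sub>L real" where \<Phi>: "\<And>d. norm (\<Phi> d) \<le> 1" "\<And>d. \<Phi> d d = norm d" by metis
  have le: "\<bar>\<Phi> d y\<bar> \<le> norm y" for d y
    using norm_blinfun[of "\<Phi> d" y] mult_right_mono[OF \<Phi>(1)[of d] norm_ge_zero[of y]] by simp
  \<comment> \<open>Points of D need not lie in M. If d is within e/2 of y and
    \<open>\<Phi> d\<close> vanishes at y, then norm d = \<Phi> d (d - y) \<le> norm (d - y), so y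
    has norm below e.\<close>
  have sep: "y = 0" if "y \<in> M" "\<And>d. d \<in> D \<Longrightarrow> \<Phi> d y = 0" for y
  proof -
    have "norm y \<le> 0 + e" if "e > 0" for e
    proof -
      obtain d where d: "d \<in> D" "dist d y < e / 2"
        using D(2) \<open>y \<in> M\<close> \<open>e > 0\<close> by (meson closure_approachable half_gt_zero subsetD)
      have "norm d = \<Phi> d (d - y)"
        using \<Phi>(2) d \<open>\<And>d. d \<in> D \<Longrightarrow> \<Phi> d y = 0\<close> by (simp add: blinfun.diff_right)
      then have "norm d \<le> norm (d - y)"
        using le[of d "d - y"] by simp
      then show ?thesis
        using d(2) norm_triangle_ineq2[of y d] by (simp add: dist_norm norm_minus_commute)
    qed
    then have "norm y \<le> 0" by (rule field_le_epsilon)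
    then show ?thesis by simp
  qed
  \<comment> \<open>A diagonal argument over the countable set D; the bound C is kept because every
    \<open>\<Phi> d\<close> has norm at most 1.\<close>
  obtain r where r: "strict_mono (r :: nat \<Rightarrow> nat)"
    "\<And>d. d \<in> D \<Longrightarrow> \<exists>c. (\<lambda>n. \<Phi> d (w (r n))) \<longlonglongrightarrow> c"
  proof (rule function_convergent_subsequence[OF D(1), of "\<lambda>n d. \<Phi> d (w n)" C])
    show "norm (\<Phi> d (w n)) \<le> C" for d n
      using order_trans[OF le w] by simp
  qed auto
  obtain c where c: "\<And>d. d \<in> D \<Longrightarrow> (\<lambda>n. \<Phi> d (w (r n))) \<longlonglongrightarrow> c d"
    using r(2) by metis
  \<comment> \<open>A functional vanishing on M has limit 0 along the sequence, so it vanishes at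
    every generalized limit; the closed subspace M therefore contains them all.\<close>
  have in_M: "x \<in> M"
    if "\<And>(\<phi> :: 'a \<Rightarrow>\<^sub>L real) c. (\<lambda>n. blinfun_apply \<phi> (w (k n))) \<longlonglongrightarrow> c \<Longrightarrow> blinfun_apply \<phi> x = c" for x k
  proof (rule ccontr)
    assume "x \<notin> M"
    then obtain \<phi> :: "'a \<Rightarrow>\<^sub>L real" where "\<And>y. y \<in> M \<Longrightarrow> \<phi> y = 0" "\<phi> x \<noteq> 0"
      using Hahn_Banach_closed_subspace[OF M] by metis
    then show False using that[of \<phi> 0] wM by simp
  qed
  obtain x where x: "\<And>(\<phi> :: 'a \<Rightarrow>\<^sub>L real) c. (\<lambda>n. blinfun_apply \<phi> (w (r n))) \<longlonglongrightarrow> c \<Longrightarrow> blinfun_apply \<phi> x = c"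
    using reflexive_generalized_limit[OF refl, of "\<lambda>n. w (r n)"] w by metis
  have "(w \<circ> r) \<rightharpoonup> x"
    unfolding weakly_converges_def
  proof (rule allI, rule ccontr)
    fix \<phi> :: "'a \<Rightarrow>\<^sub>L real" assume not: "\<not> (\<lambda>n. \<phi> ((w \<circ> r) n)) \<longlonglongrightarrow> \<phi> x"
    have "\<bar>\<phi> ((w \<circ> r) n)\<bar> \<le> norm \<phi> * C" for n
      using norm_blinfun[of \<phi> "w (r n)"] mult_left_mono[OF w[of "r n"] norm_ge_zero[of \<phi>]] by simp
    \<comment> \<open>The functional separates x from any generalized limit y of this further
      subsequence, since \<open>\<phi> y = a\<close>. But x and y give the same value to every
      \<open>\<Phi> d\<close> with d in D and both lie in M.\<close>
    then obtain k a where k: "strict_mono (k :: nat \<Rightarrow> nat)"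
        "((\<lambda>n. \<phi> ((w \<circ> r) n)) \<circ> k) \<longlonglongrightarrow> a" "a \<noteq> \<phi> x"
      using bounded_seq_limit_point_real[OF _ not] by metis
    obtain y where y: "\<And>(\<phi> :: 'a \<Rightarrow>\<^sub>L real) c. (\<lambda>n. blinfun_apply \<phi> (w ((r \<circ> k) n))) \<longlonglongrightarrow> c \<Longrightarrow> blinfun_apply \<phi> y = c"
      using reflexive_generalized_limit[OF refl, of "\<lambda>n. w ((r \<circ> k) n)"] w by metis
    have "\<Phi> d y = c d" if "d \<in> D" for d
      using LIMSEQ_subseq_LIMSEQ[OF c[OF that] k(1)] by (intro y) (simp add: o_def)
    then have "\<Phi> d (y - x) = 0" if "d \<in> D" for d
      using that x[OF c[OF that]] by (simp add: blinfun.diff_right)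
    then have "y - x = 0"
      using in_M[of "r \<circ> k" y] in_M[of r x] y x M(1) by (intro sep) (auto intro!: subspace_diff)
    moreover have "\<phi> y = a"
      using k(2) by (intro y) (simp add: o_def)
    ultimately show False using k(3) by simp
  qed
  with r(1) show ?thesis by (rule that)
qed

section \<open>Hilbert spaces and a Gronwall inequality\<close>

text \<open>The representing vector is the minimizer of \<open>J\<close>. The parallelogram law
  makes a minimizing sequence Cauchy, completeness supplies the minimizer, and minimality along each
  line through it is the claimed identity.\<close>

theorem Riesz_representation:
  fixes \<phi> :: "'a::{real_inner, complete_space} \<Rightarrow>\<^sub>L real"
  obtains a where "\<And>x. \<phi> x = a \<bullet> x"
proof -
  define J where "J x = (norm x)\<^sup>2 - 2 * \<phi> x" for x
  define I where "I = (INF x. J x)"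
  have low: "- (norm \<phi>)\<^sup>2 \<le> J x" for x
  proof -
    have "\<phi> x \<le> norm \<phi> * norm x"
      using norm_blinfun[of \<phi> x] by simp
    then show ?thesis
      unfolding J_def using sum_squares_bound[of "norm \<phi>" "norm x"] by linarith
  qed
  have bdd: "bdd_below (range J)"
    using low by (auto intro!: bdd_belowI[of _ "- (norm \<phi>)\<^sup>2"])
  have I: "I \<le> J x" for x
    unfolding I_def using bdd by (intro cINF_lower) auto
  have "\<exists>x. J x < I + inverse (real (Suc n))" for n
    using cInf_lessD[of "range J" "I + inverse (real (Suc n))"] unfolding I_def by auto
  then obtain x where x: "\<And>n. J (x n) < I + inverse (real (Suc n))" by metis
  have mid: "J ((1/2) *\<^sub>R (y + z)) = (J y + J z) / 2 - (norm (y - z))\<^sup>2 / 4" for y z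
  proof -
    have "(norm (y + z))\<^sup>2 + (norm (y - z))\<^sup>2 = 2 * (norm y)\<^sup>2 + 2 * (norm z)\<^sup>2"
      by (simp add: power2_norm_eq_inner inner_add_left inner_add_right inner_diff_left inner_diff_right)
    moreover have "(norm ((1/2) *\<^sub>R (y + z)))\<^sup>2 = (norm (y + z))\<^sup>2 / 4"
      by (simp add: power_divide)
    ultimately show ?thesis
      unfolding J_def by (simp add: blinfun.scaleR_right blinfun.add_right field_simps)
  qed
  have dist: "(norm (x m - x n))\<^sup>2 < 4 * i"
    if "m \<ge> N" "n \<ge> N" "inverse (real (Suc N)) \<le> i" for m n N i
  proof -
    have J: "J (x k) < I + i" if "k \<ge> N" for k
    proof -
      have "inverse (real (Suc k)) \<le> inverse (real (Suc N))"
        using that by (auto intro!: le_imp_inverse_le)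
      with x[of k] \<open>inverse (real (Suc N)) \<le> i\<close> show ?thesis by linarith
    qed
    have "I \<le> (J (x m) + J (x n)) / 2 - (norm (x m - x n))\<^sup>2 / 4"
      by (metis I mid)
    with J[OF that(1)] J[OF that(2)] show ?thesis by argo
  qed
  have "Cauchy x"
  proof (rule CauchyI)
    fix e :: real assume "e > 0"
    then obtain N where N: "inverse (real (Suc N)) < e\<^sup>2 / 4"
      using reals_Archimedean[of "e\<^sup>2/4"] by auto
    have "norm (x m - x n) < e" if "m \<ge> N" "n \<ge> N" for m n
      using dist[OF that, of "e\<^sup>2 / 4"] N \<open>e > 0\<close>
      by (intro power2_less_imp_less[of _ e]) (simp_all del: of_nat_Suc)
    then show "\<exists>M. \<forall>m\<ge>M. \<forall>n\<ge>M. norm (x m - x n) < e" by blast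
  qed
  then obtain a where a: "x \<longlonglongrightarrow> a"
    using Cauchy_convergent convergent_def by blast
  have "(\<lambda>n. J (x n)) \<longlonglongrightarrow> J a"
    unfolding J_def by (intro tendsto_intros a)
  moreover have "(\<lambda>n. I + inverse (real (Suc n))) \<longlonglongrightarrow> I"
    by (rule LIMSEQ_inverse_real_of_nat_add)
  ultimately have "J a \<le> I"
    by (rule LIMSEQ_le) (use x in \<open>auto intro: less_imp_le\<close>)
  then have min: "J a \<le> J y" for y
    using I[of y] by simp
  have "\<phi> y = a \<bullet> y" for y
  proof (cases "y = 0")
    case False
    \<comment> \<open>The minimizer of the quadratic function t \<mapsto> J (a + t y); a nonzero
      difference \<open>\<phi> y - a \<bullet> y\<close> would push J below its minimum
      there.\<close>
    define t where "t = (\<phi> y - a \<bullet> y) / (y \<bullet> y)"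
    have "J (a + t *\<^sub>R y) = J a + (t\<^sup>2 * (y \<bullet> y) - 2 * t * (\<phi> y - a \<bullet> y))"
      unfolding J_def power2_norm_eq_inner inner_add_left inner_add_right
        inner_scaleR_left inner_scaleR_right blinfun.scaleR_right blinfun.add_right inner_commute[of y a]
      by (simp add: algebra_simps power2_eq_square)
    moreover have "t\<^sup>2 * (y \<bullet> y) - 2 * t * (\<phi> y - a \<bullet> y) = - ((\<phi> y - a \<bullet> y)\<^sup>2 / (y \<bullet> y))"
      using False unfolding t_def by (simp add: field_simps power2_eq_square)
    ultimately have "(\<phi> y - a \<bullet> y)\<^sup>2 / (y \<bullet> y) \<le> 0"
      using min[of "a + t *\<^sub>R y"] by simp
    then show ?thesis
      using False inner_gt_zero_iff[of y]
      by (auto simp: divide_le_0_iff simp del: inner_gt_zero_iff)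
  qed simp
  then show ?thesis by (rule that)
qed

text \<open>Riesz is used twice: for \<open>\<Psi>\<close> composed with the embedding of the space
  into its dual, which produces x, and for each functional, which shows that the embedding reaches
  the whole dual.\<close>

lemma reflexive_Hilbert: "reflexive_space TYPE('a::{real_inner, complete_space})"
  unfolding reflexive_space_def
proof
  fix \<Psi> :: "('a \<Rightarrow>\<^sub>L real) \<Rightarrow>\<^sub>L real"
  define \<iota> where "\<iota> = Blinfun (\<lambda>y::'a. blinfun_inner_left y)"
  have "bounded_linear (\<lambda>y::'a. blinfun_inner_left y)"
    by (rule bounded_linear_blinfun_inner_left)
  then have \<iota>: "\<iota> y = blinfun_inner_left y" for y
    by (simp add: \<iota>_def bounded_linear_Blinfun_apply)
  obtain x where x: "\<And>y. (\<Psi> o\<^sub>L \<iota>) y = x \<bullet> y"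
    using Riesz_representation[of "\<Psi> o\<^sub>L \<iota>"] by metis
  show "\<exists>x. \<forall>\<phi>. \<Psi> \<phi> = \<phi> x"
  proof (intro exI allI)
    fix \<phi> :: "'a \<Rightarrow>\<^sub>L real"
    obtain a where a: "\<And>y. \<phi> y = a \<bullet> y"
      using Riesz_representation[of \<phi>] by metis
    have "\<phi> = blinfun_inner_left a"
      by (rule blinfun_eqI) (simp add: a inner_commute)
    then show "\<Psi> \<phi> = \<phi> x"
      using x[of a] by (simp add: \<iota> inner_commute)
  qed
qed

section \<open>Weakly convergent sequences in Hilbert spaces and uniform boundedness\<close>

lemma weakly_converges_inner:
  fixes x :: "nat \<Rightarrow> 'a::real_inner"
  assumes "x \<rightharpoonup> l"
  shows "(\<lambda>n. x n \<bullet> v) \<longlonglongrightarrow> l \<bullet> v"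
proof -
  have "(\<lambda>n. blinfun_inner_left v (x n)) \<longlonglongrightarrow> blinfun_inner_left v l"
    using assms unfolding weakly_converges_def by blast
  then show ?thesis by (simp add: inner_commute)
qed

lemma weakly_converges_diff: "x \<rightharpoonup> l \<Longrightarrow> y \<rightharpoonup> k \<Longrightarrow> (\<lambda>n. x n - y n) \<rightharpoonup> l - k"
  unfolding weakly_converges_def by (simp add: blinfun.diff_right tendsto_diff)

lemma weakly_converges_scaleR: "x \<rightharpoonup> l \<Longrightarrow> (\<lambda>n. c *\<^sub>R x n) \<rightharpoonup> c *\<^sub>R l"
  unfolding weakly_converges_def by (simp add: blinfun.scaleR_right tendsto_mult_left)

lemma weakly_converges_subseq:
  assumes "x \<rightharpoonup> l" "strict_mono r"
  shows "(x \<circ> r) \<rightharpoonup> l"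
  unfolding weakly_converges_def
proof
  fix \<phi> :: "'a \<Rightarrow>\<^sub>L real"
  have "(\<lambda>n. \<phi> (x n)) \<longlonglongrightarrow> \<phi> l"
    using assms(1) unfolding weakly_converges_def by blast
  from LIMSEQ_subseq_LIMSEQ[OF this assms(2)] show "(\<lambda>n. \<phi> ((x \<circ> r) n)) \<longlonglongrightarrow> \<phi> l"
    by (simp add: o_def)
qed

lemma tendsto_imp_weakly_converges: "x \<longlonglongrightarrow> l \<Longrightarrow> x \<rightharpoonup> l"
  unfolding weakly_converges_def by (simp add: blinfun.tendsto)

text \<open>By Baire some \<open>E k\<close> contains a ball. A vector y of length r is the
  difference of a point of that ball and its centre, so \<open>T i y\<close> has norm at most 2k;
  this is the origin of the constant 2k/r.\<close>

theorem uniform_boundedness: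
  fixes T :: "'i \<Rightarrow> 'a::{real_normed_vector, complete_space} \<Rightarrow>\<^sub>L 'b::real_normed_vector"
  assumes pw: "\<And>x. \<exists>C. \<forall>i. norm (T i x) \<le> C"
  obtains C where "\<And>i. norm (T i) \<le> C"
proof -
  define E where "E k = {x. \<forall>i. norm (T i x) \<le> real k}" for k :: nat
  have cl: "closed (E k)" for k
    unfolding E_def by (intro closed_Collect_all closed_Collect_le continuous_intros)
  have "\<Union> (range E) = UNIV"
  proof (intro equalityI subset_UNIV subsetI)
    fix x
    obtain C where C: "\<And>i. norm (T i x) \<le> C" using pw by blast
    obtain k where "C \<le> real k" using real_arch_simple by blast
    then show "x \<in> \<Union> (range E)"
      unfolding E_def using C order_trans by blast
  qed
  have "\<exists>k. interior (E k) \<noteq> {}"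
  proof (rule ccontr)
    assume "\<not> (\<exists>k. interior (E k) \<noteq> {})"
    then have "euclidean interior_of \<Union> (range E) = {}"
      using cl by (intro Baire_category_alt) (auto simp: completely_metrizable_space_euclidean)
    then show False
      using \<open>\<Union> (range E) = UNIV\<close> by simp
  qed
  then obtain k a where "a \<in> interior (E k)" by blast
  then obtain r where r: "r > 0" "cball a r \<subseteq> E k"
    using mem_interior_cball by blast
  have "norm (T i) \<le> 2 * real k / r" for i
  proof (rule norm_blinfun_bound)
    show "0 \<le> 2 * real k / r" using r(1) by simp
    fix x
    show "norm (T i x) \<le> 2 * real k / r * norm x"
    proof (cases "x = 0")
      case False
      define y where "y = (r / norm x) *\<^sub>R x"
      have "norm y = r" using False r(1) by (simp add: y_def)
      then have "a + y \<in> E k" "a \<in> E k"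
        using r by (auto simp: dist_norm subset_eq)
      then have b: "norm (T i (a + y)) \<le> k" "norm (T i a) \<le> k"
        by (auto simp: E_def)
      have "T i y = T i (a + y) - T i a"
        by (simp add: blinfun.add_right)
      then have "norm (T i y) \<le> 2 * real k"
        using norm_triangle_ineq4[of "T i (a + y)" "T i a"] b by simp
      moreover have "norm (T i y) = r / norm x * norm (T i x)"
        using r(1) by (simp add: y_def blinfun.scaleR_right)
      ultimately show ?thesis
        using False r(1) by (simp add: field_simps)
    qed simp
  qed
  then show ?thesis by (rule that)
qed

text \<open>The functionals given by the \<open>x n\<close> are pointwise bounded because the scalar
  products converge, so uniform boundedness applies; evaluating each functional at its own vector
  recovers the norm.\<close>

lemma weakly_converges_norm_bounded:
  fixes x :: "nat \<Rightarrow> 'a::{real_inner, complete_space}"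
  assumes "x \<rightharpoonup> l"
  obtains C where "\<And>n. norm (x n) \<le> C"
proof -
  have "\<exists>C. \<forall>n. norm (blinfun_inner_left (x n) y) \<le> C" for y
    using convergent_imp_Bseq[OF convergentI[OF weakly_converges_inner[OF assms, of y]]]
    by (auto simp: Bseq_def inner_commute)
  then obtain C where C: "\<And>n. norm (blinfun_inner_left (x n)) \<le> C"
    using uniform_boundedness[of "\<lambda>n. blinfun_inner_left (x n)"] by metis
  have "norm (x n) \<le> norm (blinfun_inner_left (x n))" for n
  proof (cases "x n = 0")
    case False
    have "norm (x n) * norm (x n) \<le> norm (blinfun_inner_left (x n)) * norm (x n)"
      using norm_blinfun[of "blinfun_inner_left (x n)" "x n"]
      by (simp add: dot_square_norm power2_eq_square)
    then show ?thesis using False by simp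
  qed simp
  then show ?thesis
    using C by (intro that[of C]) (rule order_trans)
qed

lemma tendsto_inner_weak_strong:
  fixes x :: "nat \<Rightarrow> 'a::{real_inner, complete_space}"
  assumes x: "x \<rightharpoonup> l" and y: "y \<longlonglongrightarrow> k"
  shows "(\<lambda>n. x n \<bullet> y n) \<longlonglongrightarrow> l \<bullet> k"
proof -
  obtain C where C: "\<And>n. norm (x n) \<le> C"
    using weakly_converges_norm_bounded[OF x] by blast
  have "(\<lambda>n. x n \<bullet> (y n - k)) \<longlonglongrightarrow> 0"
  proof (rule Lim_null_comparison)
    show "\<forall>\<^sub>F n in sequentially. norm (x n \<bullet> (y n - k)) \<le> C * norm (y n - k)"
      using order_trans[OF Cauchy_Schwarz_ineq2 mult_right_mono[OF C norm_ge_zero]]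
      by (intro always_eventually) simp
    show "(\<lambda>n. C * norm (y n - k)) \<longlonglongrightarrow> 0"
      using y by (intro tendsto_mult_right_zero tendsto_norm_zero LIM_zero)
  qed
  then have "(\<lambda>n. x n \<bullet> (y n - k) + x n \<bullet> k) \<longlonglongrightarrow> 0 + l \<bullet> k"
    using weakly_converges_inner[OF x] by (rule tendsto_add)
  then show ?thesis by (simp add: inner_diff_right)
qed

text \<open>The perturbation e enters only through its integral, because dominated convergence will
  provide a small integral and no uniform bound. \<open>G\<close> starts at 0 and does not increase;
  replacing the exponential factor of e by 1 uses that e is nonnegative.\<close>

lemma Gronwall_integral:
  fixes d e :: "real \<Rightarrow> real"
  assumes d: "continuous_on {0..T} d" and e: "continuous_on {0..T} e" and T: "0 \<le> T" and C: "0 \<le> C"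
    and e0: "\<And>t. t \<in> {0..T} \<Longrightarrow> 0 \<le> e t"
    and le: "\<And>t. t \<in> {0..T} \<Longrightarrow> d t \<le> e t + C * integral {0..t} d"
  shows "integral {0..T} d \<le> exp (C * T) * integral {0..T} e"
proof -
  define G where "G t = exp (- (C * t)) * integral {0..t} d - integral {0..t} e" for t
  have G': "(G has_real_derivative exp (- (C * t)) * (d t - C * integral {0..t} d) - e t) (at t within {0..T})"
    if "t \<in> {0..T}" for t
  proof -
    have "((\<lambda>t. exp (- (C * t))) has_real_derivative - (C * exp (- (C * t)))) (at t within {0..T})"
      by (auto intro!: derivative_eq_intros)
    from DERIV_diff[OF DERIV_mult[OF this integral_has_real_derivative[OF d that]]
        integral_has_real_derivative[OF e that]]
    show ?thesis
      unfolding G_def by (simp add: algebra_simps)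
  qed
  have "G T \<le> G 0"
  proof (rule DERIV_nonpos_imp_decreasing_open[OF T])
    show "continuous_on {0..T} G"
      using G' by (rule DERIV_continuous_on)
    fix t assume t: "0 < t" "t < T"
    have "exp (- (C * t)) * (d t - C * integral {0..t} d) \<le> exp (- (C * t)) * e t"
      using le[of t] t by (intro mult_left_mono) auto
    also have "\<dots> \<le> 1 * e t"
      using e0[of t] t C by (intro mult_right_mono) auto
    finally have "exp (- (C * t)) * (d t - C * integral {0..t} d) - e t \<le> 0" by simp
    then show "\<exists>y. (G has_real_derivative y) (at t) \<and> y \<le> 0"
      using G'[of t] t at_within_Icc_at[of 0 t T] by auto
  qed
  then have "exp (C * T) * (exp (- (C * T)) * integral {0..T} d) \<le> exp (C * T) * integral {0..T} e"
    by (intro mult_left_mono) (simp_all add: G_def)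
  then show ?thesis
    by (simp add: mult.assoc[symmetric] flip: exp_add)
qed

section \<open>Convergence of solutions\<close>

text \<open>At a nonzero \<mu> every quotient is at most \<open>K / norm \<mu>\<close>, hence so is
  the supremum. With K = 0 this gives uniqueness of the multiplier; with K read off the equation it
  bounds the multipliers.\<close>

lemma inf_sup_bound:
  assumes b: "inf_sup_bilinear_form M \<alpha> b"
    and K: "0 \<le> K" and le: "\<And>v. b v \<mu> \<le> K * norm v"
  shows "\<alpha> * norm \<mu> \<le> K"
proof (cases "\<mu> = 0")
  case False
  have "ereal \<alpha> \<le> (INF \<mu>\<in>{\<mu>. \<mu> \<noteq> 0}. SUP v\<in>{v. v \<noteq> 0}. ereal (b v \<mu> / (norm v * norm \<mu>)))"
    using b by (simp add: inf_sup_bilinear_form_def)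
  also have "\<dots> \<le> (SUP v\<in>{v. v \<noteq> 0}. ereal (b v \<mu> / (norm v * norm \<mu>)))"
    using False by (intro INF_lower) simp
  also have "\<dots> \<le> ereal (K / norm \<mu>)"
  proof (rule SUP_least)
    fix v :: 'a assume "v \<in> {v. v \<noteq> 0}"
    then show "ereal (b v \<mu> / (norm v * norm \<mu>)) \<le> ereal (K / norm \<mu>)"
      using False le[of v] by (simp add: field_simps)
  qed
  finally show ?thesis
    using False by (simp add: field_simps)
qed (simp add: K)

lemma continuous_on_atLeast_bounded:
  fixes g :: "real \<Rightarrow> 'a::real_normed_vector"
  assumes "continuous_on {0..} g"
  shows "\<exists>K. \<forall>t\<in>{0..T}. norm (g t) \<le> K"
proof -
  have "compact (g ` {0..T})"
    by (intro compact_continuous_image continuous_on_subset[OF assms]) auto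
  from compact_imp_bounded[OF this] show ?thesis
    by (auto simp: bounded_iff)
qed

text \<open>The form and the constraint sets are controlled along all subsequences, because convergence of
  the solutions is proved by contradiction along a subsequence.\<close>

locale convergent_mixed_problems =
  fixes \<pi> :: "'x::{real_inner, complete_space} \<Rightarrow> 'z::{real_inner, complete_space}"
    and A :: "nat \<Rightarrow> 'x \<Rightarrow> 'x" and A0 :: "'x \<Rightarrow> 'x"
    and S :: "nat \<Rightarrow> (real \<Rightarrow> 'x) \<Rightarrow> real \<Rightarrow> 'x" and S0 :: "(real \<Rightarrow> 'x) \<Rightarrow> real \<Rightarrow> 'x"
    and b :: "nat \<Rightarrow> 'x \<Rightarrow> 'y::{real_inner, complete_space} \<Rightarrow> real" and b0 :: "'x \<Rightarrow> 'y \<Rightarrow> real"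
    and \<Lambda> :: "nat \<Rightarrow> 'y set" and \<Lambda>0 :: "'y set"
    and f :: "nat \<Rightarrow> real \<Rightarrow> 'z" and f0 :: "real \<Rightarrow> 'z"
    and h :: "nat \<Rightarrow> real \<Rightarrow> 'x" and h0 :: "real \<Rightarrow> 'x"
    and u :: "nat \<Rightarrow> real \<Rightarrow> 'x" and u0 :: "real \<Rightarrow> 'x"
    and l :: "nat \<Rightarrow> real \<Rightarrow> 'y" and l0 :: "real \<Rightarrow> 'y"
    and m0 L0 \<alpha>0 :: real and s0 :: "nat \<Rightarrow> real"
  assumes \<pi>: "bounded_linear \<pi>"
    and \<pi>_weak_strong: "\<And>v v'. v \<rightharpoonup> v' \<Longrightarrow> (\<lambda>n. \<pi> (v n)) \<longlonglongrightarrow> \<pi> v'"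
    and m0: "m0 > 0" and L0: "L0 > 0" and \<alpha>0: "\<alpha>0 > 0" and s0: "\<And>m. s0 m \<ge> 0"
    and A_monotone: "\<And>n v w. m0 * (norm (v - w))\<^sup>2 \<le> (A n v - A n w) \<bullet> (v - w)"
    and A_Lipschitz: "\<And>n v w. norm (A n v - A n w) \<le> L0 * norm (v - w)"
    and A_conv: "\<And>v. (\<lambda>n. A n v) \<longlonglongrightarrow> A0 v"
    and S_history: "\<And>n m v w t. \<lbrakk>continuous_on {0..} v; continuous_on {0..} w; t \<in> {0..real m}\<rbrakk> \<Longrightarrow>
        norm (S n v t - S n w t) \<le> s0 m * integral {0..t} (\<lambda>r. norm (v r - w r))"
    and S_conv: "\<And>v t. \<lbrakk>continuous_on {0..} v; 0 \<le> t\<rbrakk> \<Longrightarrow> (\<lambda>n. S n v t) \<longlonglongrightarrow> S0 v t"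
    and S_bdd: "\<And>m. \<exists>K. \<forall>n. \<forall>t\<in>{0..real m}. norm (S n (\<lambda>_. 0) t) \<le> K"
    and b_bilinear: "\<And>n. bilinear (b n)" and b0_bilinear: "bilinear b0"
    and b_inf_sup: "\<And>n K \<mu>. \<lbrakk>0 \<le> K; \<And>v. b n v \<mu> \<le> K * norm v\<rbrakk> \<Longrightarrow> \<alpha>0 * norm \<mu> \<le> K"
    and b0_inj: "\<And>\<mu>. (\<And>v. b0 v \<mu> = 0) \<Longrightarrow> \<mu> = 0"
    and b_conv: "\<And>r z z' \<mu>n \<mu>. \<lbrakk>strict_mono r; z \<rightharpoonup> z'; \<mu>n \<rightharpoonup> \<mu>\<rbrakk> \<Longrightarrow> (\<lambda>n. b (r n) (z n) (\<mu>n n)) \<longlonglongrightarrow> b0 z' \<mu>"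
    and zero_in_\<Lambda>: "\<And>n. 0 \<in> \<Lambda> n"
    and \<Lambda>_strong: "\<And>\<mu>. \<mu> \<in> \<Lambda>0 \<Longrightarrow> \<exists>\<mu>n. (\<forall>n. \<mu>n n \<in> \<Lambda> n) \<and> \<mu>n \<longlonglongrightarrow> \<mu>"
    and \<Lambda>_weak: "\<And>r \<mu>n \<mu>. \<lbrakk>strict_mono r; \<And>n. \<mu>n n \<in> \<Lambda> (r n); \<mu>n \<rightharpoonup> \<mu>\<rbrakk> \<Longrightarrow> \<mu> \<in> \<Lambda>0"
    and f_conv: "\<And>t. 0 \<le> t \<Longrightarrow> (\<lambda>n. f n t) \<rightharpoonup> f0 t" and h_conv: "\<And>t. 0 \<le> t \<Longrightarrow> (\<lambda>n. h n t) \<rightharpoonup> h0 t"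
    and f_bdd: "\<And>m. \<exists>K. \<forall>n. \<forall>t\<in>{0..real m}. norm (f n t) \<le> K"
    and h_bdd: "\<And>m. \<exists>K. \<forall>n. \<forall>t\<in>{0..real m}. norm (h n t) \<le> K"
    and sol: "\<And>n. mixed_solution (A n) (S n) (b n) (\<Lambda> n) \<pi> (f n) (h n) (u n) (l n)"
    and sol0: "mixed_solution A0 S0 b0 \<Lambda>0 \<pi> f0 h0 u0 l0"
begin

lemma u_continuous: "continuous_on {0..} (u n)" and u0_continuous: "continuous_on {0..} u0"
  using sol[of n] sol0 unfolding mixed_solution_def
  by (auto dest!: continuous_on_fst)

lemma l_mem: "0 \<le> t \<Longrightarrow> l n t \<in> \<Lambda> n" and l0_mem: "0 \<le> t \<Longrightarrow> l0 t \<in> \<Lambda>0"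
  using sol[of n] sol0 unfolding mixed_solution_def by auto

lemma equation: "0 \<le> t \<Longrightarrow> A n (u n t) \<bullet> v + S n (u n) t \<bullet> v + b n v (l n t) = f n t \<bullet> \<pi> v"
  and equation0: "0 \<le> t \<Longrightarrow> A0 (u0 t) \<bullet> v + S0 u0 t \<bullet> v + b0 v (l0 t) = f0 t \<bullet> \<pi> v"
  using sol[of n] sol0 unfolding mixed_solution_def by blast+

lemma inequality:
    "\<lbrakk>0 \<le> t; \<mu> \<in> \<Lambda> n\<rbrakk> \<Longrightarrow> b n (u n t) (\<mu> - l n t) \<le> b n (h n t) (\<mu> - l n t)"
  and inequality0:
    "\<lbrakk>0 \<le> t; \<mu> \<in> \<Lambda>0\<rbrakk> \<Longrightarrow> b0 (u0 t) (\<mu> - l0 t) \<le> b0 (h0 t) (\<mu> - l0 t)"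
  using sol[of n] sol0 unfolding mixed_solution_def by blast+

text \<open>The equation is tested with \<open>u n t - h n t\<close> because the variational
  inequality compares u only with h: the multiplier 0 there gives the coupling term a sign, and it
  drops out. Strong monotonicity is applied between u and h, whence the term
  \<open>A n (h n t)\<close>.\<close>

lemma norm_u_le_history:
  assumes t: "0 \<le> t" and K0: "0 \<le> K" and K: "\<And>x. norm (\<pi> x) \<le> norm x * K"
  shows "m0 * norm (u n t - h n t) \<le> norm (f n t) * K + norm (S n (u n) t) + norm (A n (h n t))"
proof -
  define x where "x = u n t - h n t"
  have "b n (u n t) (0 - l n t) \<le> b n (h n t) (0 - l n t)"
    by (rule inequality[OF t zero_in_\<Lambda>])
  then have b: "0 \<le> b n x (l n t)"
    by (simp add: x_def bilinear_rneg[OF b_bilinear] bilinear_lsub[OF b_bilinear])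
  have CS: "v \<bullet> x \<le> norm v * norm x" "- (v \<bullet> x) \<le> norm v * norm x" for v
    using Cauchy_Schwarz_ineq2[of v x] by auto
  have "m0 * (norm x)\<^sup>2 \<le> (A n (u n t) - A n (h n t)) \<bullet> x"
    unfolding x_def by (rule A_monotone)
  also have "\<dots> \<le> f n t \<bullet> \<pi> x - S n (u n) t \<bullet> x - A n (h n t) \<bullet> x"
    using equation[OF t, of n x] b by (simp add: inner_diff_left)
  also have "\<dots> \<le> norm (f n t) * (norm x * K) + norm (S n (u n) t) * norm x + norm (A n (h n t)) * norm x"
    using norm_cauchy_schwarz[of "f n t" "\<pi> x"] mult_left_mono[OF K[of x] norm_ge_zero[of "f n t"]]
      CS(2)[of "S n (u n) t"] CS(2)[of "A n (h n t)"] by linarith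
  finally have *: "(m0 * norm x) * norm x
      \<le> (norm (f n t) * K + norm (S n (u n) t) + norm (A n (h n t))) * norm x"
    by (simp add: algebra_simps power2_eq_square)
  show ?thesis
  proof (cases "x = 0")
    case True
    with K0 show ?thesis by (simp add: x_def)
  next
    case False
    with * show ?thesis by (simp add: x_def)
  qed
qed

text \<open>Uniformity in n and in t up to m serves weak compactness at each time and domination
  under the time integral. Gronwall removes the history term; the equation, read as a bound on the
  coupling form, then controls the multipliers through the inf-sup estimate.\<close>

lemma solutions_bounded:
  obtains K where "\<And>n t. t \<in> {0..real m} \<Longrightarrow> norm (u n t) \<le> K"
    "\<And>n t. t \<in> {0..real m} \<Longrightarrow> norm (l n t) \<le> K"
proof -
  obtain K\<pi> where K\<pi>: "0 < K\<pi>" "\<And>x. norm (\<pi> x) \<le> norm x * K\<pi>"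
    using bounded_linear.pos_bounded[OF \<pi>] by blast
  obtain Kf where Kf: "\<And>n t. t \<in> {0..real m} \<Longrightarrow> norm (f n t) \<le> Kf" using f_bdd by metis
  obtain Kh where Kh: "\<And>n t. t \<in> {0..real m} \<Longrightarrow> norm (h n t) \<le> Kh" using h_bdd by metis
  obtain KS where KS: "\<And>n t. t \<in> {0..real m} \<Longrightarrow> norm (S n (\<lambda>_. 0) t) \<le> KS" using S_bdd by metis
  obtain KA where KA: "\<And>n. norm (A n 0) \<le> KA"
    using convergent_imp_Bseq[OF convergentI[OF A_conv[of 0]]] by (auto simp: Bseq_def)
  have nonneg: "0 \<le> Kf" "0 \<le> Kh" "0 \<le> KS" "0 \<le> KA"
    using order_trans[OF norm_ge_zero Kf[of 0 0]] order_trans[OF norm_ge_zero Kh[of 0 0]]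
      order_trans[OF norm_ge_zero KS[of 0 0]] order_trans[OF norm_ge_zero KA[of 0]] by auto
  have A_le: "norm (A n v) \<le> KA + L0 * norm v" for n v
    using A_Lipschitz[of n v 0] KA[of n] norm_triangle_sub[of "A n v" "A n 0"] by simp
  have cont: "continuous_on {0..t} (\<lambda>r. norm (u n r))" for n t
    by (intro continuous_intros continuous_on_subset[OF u_continuous]) auto
  have S_le: "norm (S n (u n) t) \<le> KS + s0 m * integral {0..t} (\<lambda>r. norm (u n r))"
    if "t \<in> {0..real m}" for n t
    using S_history[OF u_continuous[of n] continuous_on_const[of _ "0::'x"] that, of n] KS[OF that, of n]
      norm_triangle_sub[of "S n (u n) t" "S n (\<lambda>_. 0) t"] by simp
  \<comment> \<open>The history-free part of the estimate divided by \<open>m0\<close>; the last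
    \<open>Kh\<close> pays for passing from u - h to u.\<close>
  define K1 where "K1 = (Kf * K\<pi> + KS + (KA + L0 * Kh)) / m0 + Kh"
  define C where "C = s0 m / m0"
  have C: "0 \<le> C" unfolding C_def using s0 m0 by simp
  have K1: "0 \<le> K1"
    unfolding K1_def using nonneg K\<pi>(1) L0 m0 by simp
  have u_le: "norm (u n t) \<le> K1 + C * integral {0..t} (\<lambda>r. norm (u n r))"
    if t: "t \<in> {0..real m}" for n t
  proof -
    have "norm (A n (h n t)) \<le> KA + L0 * Kh"
      using A_le[of n "h n t"] mult_left_mono[OF Kh[OF t], of L0 n] L0 by linarith
    moreover have "norm (f n t) * K\<pi> \<le> Kf * K\<pi>"
      using Kf[OF t] K\<pi>(1) by (simp add: mult_right_mono)
    ultimately have "m0 * norm (u n t - h n t) \<le> Kf * K\<pi> + (KS + s0 m * integral {0..t} (\<lambda>r. norm (u n r)))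
        + (KA + L0 * Kh)"
      using norm_u_le_history[OF _ less_imp_le[OF K\<pi>(1)] K\<pi>(2), of t n] S_le[OF t, of n] t
      by (simp del: norm_le_zero_iff)
    then have "norm (u n t - h n t) \<le> (Kf * K\<pi> + (KS + s0 m * integral {0..t} (\<lambda>r. norm (u n r)))
        + (KA + L0 * Kh)) / m0"
      using m0 by (simp add: pos_le_divide_eq mult.commute)
    then have "norm (u n t - h n t) \<le> (K1 - Kh) + C * integral {0..t} (\<lambda>r. norm (u n r))"
      by (simp add: K1_def C_def add_divide_distrib)
    then show ?thesis
      using norm_triangle_sub[of "u n t" "h n t"] Kh[OF t, of n] by linarith
  qed
  \<comment> \<open>Gronwall bounds the integral first; inserted into \<open>u_le\<close>, it yields
    the pointwise bound \<open>Ku\<close>.\<close>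
  have int_le: "integral {0..t} (\<lambda>r. norm (u n r)) \<le> exp (C * real m) * (real m * K1)"
    if t: "t \<in> {0..real m}" for n t
  proof -
    have "integral {0..t} (\<lambda>r. norm (u n r)) \<le> exp (C * t) * integral {0..t} (\<lambda>_. K1)"
      using t C K1 u_le by (intro Gronwall_integral cont) auto
    also have "\<dots> = exp (C * t) * (t * K1)"
      using t by simp
    also have "\<dots> \<le> exp (C * real m) * (real m * K1)"
      using t C K1 by (intro mult_mono) (auto intro: mult_left_mono)
    finally show ?thesis .
  qed
  define I where "I = exp (C * real m) * (real m * K1)"
  define Ku where "Ku = K1 + C * I"
  have Ku: "norm (u n t) \<le> Ku" if "t \<in> {0..real m}" for n t
    using u_le[OF that, of n] mult_left_mono[OF int_le[OF that, of n] C] unfolding Ku_def I_def by linarith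
  \<comment> \<open>Bounds for the three other terms of the equation, divided by the inf-sup
    constant.\<close>
  define Kl where "Kl = (Kf * K\<pi> + (KA + L0 * Ku) + (KS + s0 m * I)) / \<alpha>0"
  have Kl: "norm (l n t) \<le> Kl" if t: "t \<in> {0..real m}" for n t
  proof -
    let ?K = "norm (f n t) * K\<pi> + norm (A n (u n t)) + norm (S n (u n) t)"
    have "\<alpha>0 * norm (l n t) \<le> ?K"
    proof (rule b_inf_sup)
      show "0 \<le> ?K" using K\<pi>(1) by simp
      fix v
      have "b n v (l n t) = f n t \<bullet> \<pi> v - A n (u n t) \<bullet> v - S n (u n) t \<bullet> v"
        using equation[of t n v] t by simp
      also have "\<dots> \<le> norm (f n t) * (norm v * K\<pi>) + norm (A n (u n t)) * norm v + norm (S n (u n) t) * norm v"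
        using norm_cauchy_schwarz[of "f n t" "\<pi> v"] mult_left_mono[OF K\<pi>(2)[of v] norm_ge_zero[of "f n t"]]
          Cauchy_Schwarz_ineq2[of "A n (u n t)" v] Cauchy_Schwarz_ineq2[of "S n (u n) t" v] by linarith
      finally show "b n v (l n t) \<le> ?K * norm v" by (simp add: algebra_simps)
    qed
    moreover have "norm (f n t) * K\<pi> \<le> Kf * K\<pi>"
      using Kf[OF t] K\<pi>(1) by (simp add: mult_right_mono)
    moreover have "norm (A n (u n t)) \<le> KA + L0 * Ku"
      using A_le[of n "u n t"] mult_left_mono[OF Ku[OF t], of L0 n] L0 by linarith
    moreover have "norm (S n (u n) t) \<le> KS + s0 m * I"
      using S_le[OF t, of n] mult_left_mono[OF int_le[OF t, of n] s0[of m]] unfolding I_def by linarith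
    ultimately have "\<alpha>0 * norm (l n t) \<le> Kf * K\<pi> + (KA + L0 * Ku) + (KS + s0 m * I)"
      by linarith
    then show ?thesis
      unfolding Kl_def using \<alpha>0 by (simp add: field_simps)
  qed
  show ?thesis
    using Ku Kl by (intro that[of "max Ku Kl"]) (auto simp: le_max_iff_disj)
qed

section \<open>Convergence of the errors at a fixed time\<close>

abbreviation err :: "nat \<Rightarrow> real \<Rightarrow> real" where
  "err n t \<equiv> norm (u n t - u0 t)"

lemma err_integrand_continuous: "continuous_on {0..t} (err n)"
  by (intro continuous_intros continuous_on_subset[OF u_continuous]
      continuous_on_subset[OF u0_continuous]) auto

text \<open>The two variational inequalities, tested with each other's multipliers, make the coupling term
  \<open>b0 (u' - u0 t) (l' - l0 t)\<close> nonnegative in the limit.\<close>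

lemma weak_limit_error_bound:
  assumes r: "strict_mono r" and t: "t \<in> {0..real m}"
    and u': "(\<lambda>n. u (r n) t) \<rightharpoonup> u'" and l': "(\<lambda>n. l (r n) t) \<rightharpoonup> l'"
    and d: "(\<lambda>n. err (r n) t) \<longlonglongrightarrow> d" and I: "(\<lambda>n. integral {0..t} (err (r n))) \<longlonglongrightarrow> I"
  shows "m0 * d \<le> s0 m * I"
proof -
  have t0: "0 \<le> t" using t by simp
  note bl = bilinear_lsub bilinear_rsub
  have sub: "(\<lambda>n. x (r n)) \<longlonglongrightarrow> x'" if "x \<longlonglongrightarrow> x'" for x :: "nat \<Rightarrow> 'x" and x'
    using LIMSEQ_subseq_LIMSEQ[OF that r] by (simp add: o_def)
  have f: "(\<lambda>n. f (r n) t) \<rightharpoonup> f0 t" and h: "(\<lambda>n. h (r n) t) \<rightharpoonup> h0 t"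
    using weakly_converges_subseq[OF f_conv[OF t0] r] weakly_converges_subseq[OF h_conv[OF t0] r]
    by (simp_all add: o_def)
  \<comment> \<open>The multiplier l' is admissible in the limit inequality by the weak half of
    Mosco convergence. In the n-th inequality \<open>l0 t\<close> itself may be inadmissible, so a
    recovery sequence from the strong half replaces it.\<close>
  have "l' \<in> \<Lambda>0"
    using r l_mem[OF t0] l' by (rule \<Lambda>_weak)
  then have ineq0: "b0 (u0 t) (l' - l0 t) \<le> b0 (h0 t) (l' - l0 t)"
    by (rule inequality0[OF t0])
  obtain \<mu> where \<mu>: "\<And>n. \<mu> n \<in> \<Lambda> n" "\<mu> \<longlonglongrightarrow> l0 t"
    using \<Lambda>_strong[OF l0_mem[OF t0]] by blast
  have "(\<lambda>n. \<mu> (r n)) \<rightharpoonup> l0 t"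
    using weakly_converges_subseq[OF tendsto_imp_weakly_converges[OF \<mu>(2)] r] by (simp add: o_def)
  then have \<mu>l: "(\<lambda>n. \<mu> (r n) - l (r n) t) \<rightharpoonup> l0 t - l'"
    using l' by (rule weakly_converges_diff)
  have ineq: "b0 u' (l0 t - l') \<le> b0 (h0 t) (l0 t - l')"
    by (rule LIMSEQ_le[OF b_conv[OF r u' \<mu>l] b_conv[OF r h \<mu>l]])
      (use inequality[OF t0 \<mu>(1)] in blast)
  have u0w: "(\<lambda>n. u (r n) t - u0 t) \<rightharpoonup> u' - u0 t"
    by (intro weakly_converges_diff u' tendsto_imp_weakly_converges) simp
  \<comment> \<open>Both operators are taken at \<open>u0\<close>, where their values converge
    strongly and can be paired with the weakly convergent u - u0.\<close>
  define \<sigma> where "\<sigma> n = S (r n) u0 t" for n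
  define a where "a n = A (r n) (u0 t)" for n
  have \<sigma>: "\<sigma> \<longlonglongrightarrow> S0 u0 t"
    unfolding \<sigma>_def by (rule sub[OF S_conv[OF u0_continuous t0]])
  have a: "a \<longlonglongrightarrow> A0 (u0 t)"
    unfolding a_def by (rule sub[OF A_conv])
  \<comment> \<open>The upper bound for \<open>m0\<close> times the squared error that results from
    testing the equation with u - u0; replacing S of u by \<open>\<sigma>\<close> costs the history
    term. Weak convergence does not determine the limit of the norms, so d and I enter as separate
    limits.\<close>
  define X where "X n = f (r n) t \<bullet> \<pi> (u (r n) t - u0 t)
      + s0 m * integral {0..t} (err (r n)) * err (r n) t - (u (r n) t - u0 t) \<bullet> \<sigma> n
      - b (r n) (u (r n) t - u0 t) (l (r n) t) - (u (r n) t - u0 t) \<bullet> a n" for n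
  have "X \<longlonglongrightarrow> f0 t \<bullet> \<pi> (u' - u0 t) + s0 m * I * d - (u' - u0 t) \<bullet> S0 u0 t
      - b0 (u' - u0 t) l' - (u' - u0 t) \<bullet> A0 (u0 t)"
    unfolding X_def
    by (intro tendsto_diff tendsto_add tendsto_mult tendsto_const I d
        tendsto_inner_weak_strong[OF f \<pi>_weak_strong[OF u0w]] tendsto_inner_weak_strong[OF u0w \<sigma>]
        tendsto_inner_weak_strong[OF u0w a] b_conv[OF r u0w l'])
  \<comment> \<open>The limit equation tested with \<open>u' - u0 t\<close> rewrites the load term
    so that the A and S terms cancel, leaving history and coupling.\<close>
  moreover have "f0 t \<bullet> \<pi> (u' - u0 t) = A0 (u0 t) \<bullet> (u' - u0 t) + S0 u0 t \<bullet> (u' - u0 t) + b0 (u' - u0 t) (l0 t)"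
    by (rule equation0[OF t0, symmetric])
  ultimately have X: "X \<longlonglongrightarrow> s0 m * I * d + b0 (u' - u0 t) (l0 t) - b0 (u' - u0 t) l'"
    by (simp add: inner_commute algebra_simps)
  have le_X: "m0 * (err (r n) t)\<^sup>2 \<le> X n" for n
  proof -
    let ?x = "u (r n) t - u0 t" and ?w = "S (r n) (u (r n)) t"
    have "norm (?w - \<sigma> n) \<le> s0 m * integral {0..t} (err (r n))"
      unfolding \<sigma>_def by (rule S_history[OF u_continuous u0_continuous t])
    then have "norm (?w - \<sigma> n) * norm ?x \<le> s0 m * integral {0..t} (err (r n)) * norm ?x"
      by (rule mult_right_mono) simp
    then have "- ((?w - \<sigma> n) \<bullet> ?x) \<le> s0 m * integral {0..t} (err (r n)) * err (r n) t"
      using Cauchy_Schwarz_ineq2[of "?w - \<sigma> n" ?x] by linarith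
    moreover have "m0 * (err (r n) t)\<^sup>2 \<le> (A (r n) (u (r n) t) - a n) \<bullet> ?x"
      unfolding a_def by (rule A_monotone)
    ultimately show ?thesis
      using equation[OF t0, of "r n" ?x]
      by (simp add: X_def inner_diff_left[of ?w] inner_diff_left[of "A (r n) (u (r n) t)"]
          inner_commute[of ?x])
  qed
  have "m0 * d\<^sup>2 \<le> s0 m * I * d + b0 (u' - u0 t) (l0 t) - b0 (u' - u0 t) l'"
    by (rule LIMSEQ_le[OF tendsto_mult[OF tendsto_const tendsto_power[OF d]] X]) (use le_X in blast)
  \<comment> \<open>Adding \<open>ineq\<close> and \<open>ineq0\<close> cancels \<open>h0\<close>
    and gives the coupling terms their sign.\<close>
  also have "\<dots> \<le> s0 m * I * d"
    using ineq ineq0 by (simp add: bl[OF b0_bilinear])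
  finally have *: "(m0 * d) * d \<le> (s0 m * I) * d"
    by (simp add: power2_eq_square)
  have "0 \<le> d"
    by (rule LIMSEQ_le_const[OF d]) simp
  moreover have "0 \<le> I"
    using t by (intro LIMSEQ_le_const[OF I] exI[of _ 0] allI impI integral_nonneg
        integrable_continuous_real err_integrand_continuous) simp
  \<comment> \<open>One factor d cancels; if d = 0, what remains is
    \<open>0 \<le> s0 m * I\<close>.\<close>
  ultimately show ?thesis
    using * s0[of m] by (cases "d = 0") simp_all
qed

text \<open>The integral is tracked besides the pointwise error because the history operator at time
  t sees the whole past.\<close>

lemma u_tendsto_and_integral_err_tendsto:
  assumes "0 \<le> t"
  shows "(\<lambda>n. u n t) \<longlonglongrightarrow> u0 t" and "(\<lambda>n. integral {0..t} (err n)) \<longlonglongrightarrow> 0"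
proof -
  obtain m where m: "t \<le> real m" using real_arch_simple by blast
  obtain Ku where Ku: "\<And>n t. t \<in> {0..real m} \<Longrightarrow> norm (u n t) \<le> Ku"
    and Kl: "\<And>n t. t \<in> {0..real m} \<Longrightarrow> norm (l n t) \<le> Ku"
    using solutions_bounded[of m] by metis
  obtain K0 where K0: "\<And>t. t \<in> {0..real m} \<Longrightarrow> norm (u0 t) \<le> K0"
    using continuous_on_atLeast_bounded[OF u0_continuous] by metis
  define K where "K = Ku + K0"
  have K: "err n t \<le> K" if "t \<in> {0..real m}" for n t
    using Ku[OF that, of n] K0[OF that] norm_triangle_ineq4[of "u n t" "u0 t"]
    unfolding K_def by linarith
  have K_nonneg: "0 \<le> K"
    using order_trans[OF norm_ge_zero K[of 0 0]] by simp
  define C where "C = s0 m / m0"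
  have C: "0 \<le> C" unfolding C_def using s0 m0 by simp
  define I where "I n t = integral {0..t} (err n)" for n t
  have err_integrable: "err n integrable_on {0..t}" for n t
    by (intro integrable_continuous_real err_integrand_continuous)
  have I_nonneg: "0 \<le> I n t" for n t
    unfolding I_def by (intro integral_nonneg err_integrable) simp
  have I_le: "I n t \<le> K * real m" if "t \<in> {0..real m}" for n t
  proof -
    have "I n t \<le> integral {0..t} (\<lambda>_. K)"
      unfolding I_def using that K by (intro integral_le err_integrable) auto
    also have "\<dots> \<le> K * real m"
      using that K_nonneg by (simp add: mult.commute mult_left_mono)
    finally show ?thesis .
  qed
  \<comment> \<open>The amount by which the error exceeds its history bound. The positive part is
    nonnegative, as Gronwall requires, and still satisfies
    \<open>err n t \<le> excess n t + C * I n t\<close>.\<close>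
  define excess where "excess n t = max 0 (err n t - C * I n t)" for n t
  have excess_nonneg: "0 \<le> excess n t" for n t
    by (simp add: excess_def)
  have excess_le: "excess n t \<le> K" if "t \<in> {0..real m}" for n t
    unfolding excess_def using K[OF that, of n] K_nonneg mult_nonneg_nonneg[OF C I_nonneg[of n t]] by auto
  \<comment> \<open>Four successive extractions at the fixed t: a wrong limit of the excess, weak
    limits of u and of l, and limits of the error and its integral. Their dependence on t is
    harmless, since only the real limit 0 is concluded.\<close>
  have excess_tendsto: "(\<lambda>n. excess n t) \<longlonglongrightarrow> 0" if t: "t \<in> {0..real m}" for t
  proof (rule ccontr)
    assume not: "\<not> (\<lambda>n. excess n t) \<longlonglongrightarrow> 0"
    have "\<bar>excess n t\<bar> \<le> K" for n
      using excess_nonneg excess_le[OF t] by simp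
    then obtain r1 c where r1: "strict_mono (r1 :: nat \<Rightarrow> nat)" "((\<lambda>n. excess n t) \<circ> r1) \<longlonglongrightarrow> c" "c \<noteq> 0"
      using bounded_seq_limit_point_real[OF _ not] by metis
    obtain r2 u' where r2: "strict_mono (r2 :: nat \<Rightarrow> nat)" "((\<lambda>n. u (r1 n) t) \<circ> r2) \<rightharpoonup> u'"
      using reflexive_weakly_convergent_subsequence[OF reflexive_Hilbert, of "\<lambda>n. u (r1 n) t" Ku]
        Ku[OF t] by metis
    obtain r3 l' where r3: "strict_mono (r3 :: nat \<Rightarrow> nat)" "((\<lambda>n. l (r1 (r2 n)) t) \<circ> r3) \<rightharpoonup> l'"
      using reflexive_weakly_convergent_subsequence[OF reflexive_Hilbert, of "\<lambda>n. l (r1 (r2 n)) t" Ku]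
        Kl[OF t] by metis
    \<comment> \<open>Pairing the two real sequences lets one compactness argument in the plane
      provide both limits.\<close>
    define g where "g n = (err (r1 (r2 (r3 n))) t, I (r1 (r2 (r3 n))) t)" for n
    have "range g \<subseteq> {0..K} \<times> {0..K * real m}"
      unfolding g_def using K[OF t] I_nonneg I_le[OF t] by auto
    then have "bounded (range g)"
      by (rule bounded_subset[OF bounded_Times[OF bounded_closed_interval bounded_closed_interval]])
    then obtain q r4 where r4: "strict_mono (r4 :: nat \<Rightarrow> nat)" "(g \<circ> r4) \<longlonglongrightarrow> q"
      using bounded_imp_convergent_subsequence[of g] by metis
    define R where "R n = r1 (r2 (r3 (r4 n)))" for n
    have R: "strict_mono R"
      using r1(1) r2(1) r3(1) r4(1) by (simp add: R_def strict_mono_def)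
    have d: "(\<lambda>n. err (R n) t) \<longlonglongrightarrow> fst q" and q: "(\<lambda>n. I (R n) t) \<longlonglongrightarrow> snd q"
      using tendsto_fst[OF r4(2)] tendsto_snd[OF r4(2)] by (simp_all add: g_def R_def o_def)
    have "(\<lambda>n. u (R n) t) \<rightharpoonup> u'"
      using weakly_converges_subseq[OF weakly_converges_subseq[OF r2(2) r3(1)] r4(1)]
      by (simp add: R_def o_def)
    moreover have "(\<lambda>n. l (R n) t) \<rightharpoonup> l'"
      using weakly_converges_subseq[OF r3(2) r4(1)] by (simp add: R_def o_def)
    ultimately have "m0 * fst q \<le> s0 m * snd q"
      using R t d q unfolding I_def by (intro weak_limit_error_bound)
    then have "fst q - C * snd q \<le> 0"
      unfolding C_def using m0 by (simp add: field_simps)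
    moreover have "(\<lambda>n. excess (R n) t) \<longlonglongrightarrow> max 0 (fst q - C * snd q)"
      unfolding excess_def by (intro tendsto_intros d q)
    ultimately have "(\<lambda>n. excess (R n) t) \<longlonglongrightarrow> 0"
      by (simp add: max.absorb1)
    moreover have "(\<lambda>n. excess (R n) t) \<longlonglongrightarrow> c"
      using LIMSEQ_subseq_LIMSEQ[OF r1(2), of "\<lambda>n. r2 (r3 (r4 n))"] r2(1) r3(1) r4(1)
      by (simp add: R_def o_def strict_mono_def)
    ultimately show False
      using r1(3) by (metis LIMSEQ_unique)
  qed
  have t: "t \<in> {0..real m}" using assms m by simp
  have excess_continuous: "continuous_on {0..t} (excess n)" for n
    unfolding excess_def I_def
    by (intro continuous_intros err_integrand_continuous indefinite_integral_continuous_1 err_integrable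
        continuous_on_subset[OF u_continuous] continuous_on_subset[OF u0_continuous]) auto
  \<comment> \<open>The constant K dominates on \<open>{0..t}\<close>, and
    \<open>excess_tendsto\<close> applies at every earlier time.\<close>
  have "(\<lambda>n. integral {0..t} (excess n)) \<longlonglongrightarrow> integral {0..t} (\<lambda>_. 0)"
  proof (rule dominated_convergence(2))
    show "excess n integrable_on {0..t}" for n
      by (intro integrable_continuous_real excess_continuous)
    show "(\<lambda>_. K) integrable_on {0..t}" by (rule integrable_const_ivl)
    show "norm (excess n s) \<le> K" if "s \<in> {0..t}" for n s
      using excess_nonneg excess_le[of s n] that t by simp
    show "(\<lambda>n. excess n s) \<longlonglongrightarrow> 0" if "s \<in> {0..t}" for s
      using excess_tendsto[of s] that t by simp
  qed
  then have bound: "(\<lambda>n. exp (C * t) * integral {0..t} (excess n)) \<longlonglongrightarrow> 0"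
    by (intro tendsto_mult_right_zero) simp
  have "I n t \<le> exp (C * t) * integral {0..t} (excess n)" for n
    unfolding I_def
  proof (rule Gronwall_integral)
    show "err n s \<le> excess n s + C * integral {0..s} (err n)" for s
      unfolding excess_def I_def by simp
  qed (use assms C excess_nonneg excess_continuous err_integrand_continuous in auto)
  then have I: "(\<lambda>n. I n t) \<longlonglongrightarrow> 0"
    using I_nonneg by (intro tendsto_sandwich[OF _ _ tendsto_const bound]) auto
  then show "(\<lambda>n. integral {0..t} (err n)) \<longlonglongrightarrow> 0"
    by (simp add: I_def)
  have "(\<lambda>n. excess n t + C * I n t) \<longlonglongrightarrow> 0 + C * 0"
    by (intro tendsto_intros excess_tendsto t I)
  then have "(\<lambda>n. excess n t + C * I n t) \<longlonglongrightarrow> 0"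
    by simp
  then have "(\<lambda>n. err n t) \<longlonglongrightarrow> 0"
    by (rule Lim_null_comparison[rotated]) (simp add: excess_def max_def)
  then show "(\<lambda>n. u n t) \<longlonglongrightarrow> u0 t"
    by (rule LIM_zero_cancel[OF tendsto_norm_zero_cancel])
qed

text \<open>Strong convergence of u and decay of the error integral carry \<open>A n\<close> and
  \<open>S n\<close> to their limits through the uniform Lipschitz and history constants. Only the
  weak limit of the multipliers requires a subsequence.\<close>

theorem solutions_convergent_subsequence:
  assumes t: "0 \<le> t"
  obtains r where "strict_mono (r :: nat \<Rightarrow> nat)" "(\<lambda>n. u (r n) t) \<longlonglongrightarrow> u0 t" "(\<lambda>n. l (r n) t) \<rightharpoonup> l0 t"
proof -
  obtain m where "t \<le> real m" using real_arch_simple by blast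
  with t have tm: "t \<in> {0..real m}" by simp
  obtain K where "\<And>n. norm (l n t) \<le> K"
    using solutions_bounded[of m] tm by metis
  then obtain r l' where r: "strict_mono (r :: nat \<Rightarrow> nat)" and l': "((\<lambda>n. l n t) \<circ> r) \<rightharpoonup> l'"
    using reflexive_weakly_convergent_subsequence[OF reflexive_Hilbert, of "\<lambda>n. l n t"] by metis
  note lims = u_tendsto_and_integral_err_tendsto[OF t]
  have A: "(\<lambda>n. A n (u n t)) \<longlonglongrightarrow> A0 (u0 t)"
  proof -
    have "(\<lambda>n. A n (u n t) - A n (u0 t)) \<longlonglongrightarrow> 0"
    proof (rule Lim_null_comparison)
      show "\<forall>\<^sub>F n in sequentially. norm (A n (u n t) - A n (u0 t)) \<le> L0 * err n t"
        using A_Lipschitz by simp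
      show "(\<lambda>n. L0 * err n t) \<longlonglongrightarrow> 0"
        using lims(1) by (intro tendsto_mult_right_zero tendsto_norm_zero LIM_zero)
    qed
    from tendsto_add[OF this A_conv[of "u0 t"]] show ?thesis by simp
  qed
  have S: "(\<lambda>n. S n (u n) t) \<longlonglongrightarrow> S0 u0 t"
  proof -
    have "(\<lambda>n. S n (u n) t - S n u0 t) \<longlonglongrightarrow> 0"
    proof (rule Lim_null_comparison)
      show "\<forall>\<^sub>F n in sequentially. norm (S n (u n) t - S n u0 t) \<le> s0 m * integral {0..t} (err n)"
        using S_history[OF u_continuous u0_continuous tm] by simp
      show "(\<lambda>n. s0 m * integral {0..t} (err n)) \<longlonglongrightarrow> 0"
        using lims(2) by (rule tendsto_mult_right_zero)
    qed
    from tendsto_add[OF this S_conv[OF u0_continuous t]] show ?thesis by simp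
  qed
  have "l' - l0 t = 0"
  proof (rule b0_inj)
    fix v
    have "(\<lambda>n. f n t \<bullet> \<pi> v - A n (u n t) \<bullet> v - S n (u n) t \<bullet> v)
        \<longlonglongrightarrow> f0 t \<bullet> \<pi> v - A0 (u0 t) \<bullet> v - S0 u0 t \<bullet> v"
      by (rule tendsto_diff[OF tendsto_diff[OF weakly_converges_inner[OF f_conv[OF t]]
            tendsto_inner[OF A tendsto_const]] tendsto_inner[OF S tendsto_const]])
    then have "(\<lambda>n. b n v (l n t)) \<longlonglongrightarrow> b0 v (l0 t)"
      using equation[OF t] equation0[OF t] by (simp add: algebra_simps flip: eq_diff_eq)
    from LIMSEQ_subseq_LIMSEQ[OF this r] have "(\<lambda>n. b (r n) v (l (r n) t)) \<longlonglongrightarrow> b0 v (l0 t)"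
      by (simp add: o_def)
    moreover have "(\<lambda>n. b (r n) v (l (r n) t)) \<longlonglongrightarrow> b0 v l'"
      using l' by (intro b_conv[OF r tendsto_imp_weakly_converges[OF tendsto_const]]) (simp add: o_def)
    ultimately show "b0 v (l' - l0 t) = 0"
      by (simp add: bilinear_rsub[OF b0_bilinear] LIMSEQ_unique)
  qed
  then have "(\<lambda>n. l (r n) t) \<rightharpoonup> l0 t"
    using l' by (simp add: o_def)
  with r LIMSEQ_subseq_LIMSEQ[OF lims(1) r] show ?thesis
    by (intro that) (simp_all add: o_def)
qed

end

section \<open>Existence of optimal parameters\<close>

lemma Mosco_converges_strong:
  "Mosco_converges K K0 \<Longrightarrow> \<mu> \<in> K0 \<Longrightarrow> \<exists>m. (\<forall>n. m n \<in> K n) \<and> m \<longlonglongrightarrow> \<mu>"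
  and Mosco_converges_weak:
  "Mosco_converges K K0 \<Longrightarrow> (\<And>n. m n \<in> K n) \<Longrightarrow> m \<rightharpoonup> \<mu> \<Longrightarrow> \<mu> \<in> K0"
  unfolding Mosco_converges_def by blast+

lemma history_dependent_continuous:
  "history_dependent s S \<Longrightarrow> continuous_on {0..} u \<Longrightarrow> continuous_on {0..} (S u)"
  by (simp add: history_dependent_def)

lemma scaleR_weakly_converges_bounded:
  fixes x :: "nat \<Rightarrow> 'a::{real_inner, complete_space}" and c :: "real \<Rightarrow> real"
  assumes "continuous_on {0..} c" "x \<rightharpoonup> x'"
  shows "\<exists>K. \<forall>n. \<forall>t\<in>{0..T}. norm (c t *\<^sub>R x n) \<le> K"
proof -
  obtain K1 where K1: "\<And>t. t \<in> {0..T} \<Longrightarrow> norm (c t) \<le> K1"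
    using continuous_on_atLeast_bounded[OF assms(1)] by metis
  obtain K2 where K2: "\<And>n. norm (x n) \<le> K2"
    using weakly_converges_norm_bounded[OF assms(2)] by metis
  have "norm (c t *\<^sub>R x n) \<le> K1 * K2" if "t \<in> {0..T}" for n t
    using mult_mono'[OF K1[OF that] K2[of n]] by simp
  then show ?thesis by blast
qed

lemma tendsto_mult_add_bounded_0:
  fixes F \<delta> :: "nat \<Rightarrow> real"
  assumes F: "F \<longlonglongrightarrow> 0" and \<delta>: "bounded (range \<delta>)"
  shows "(\<lambda>n. F n * (c + \<delta> n)) \<longlonglongrightarrow> 0"
proof -
  obtain B where B: "\<And>n. norm (\<delta> n) \<le> B"
    using \<delta> by (auto simp: bounded_iff)
  have "norm (c + \<delta> n) \<le> norm c + B" for n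
    using norm_triangle_ineq[of c "\<delta> n"] B[of n] by linarith
  then show ?thesis
    by (intro lim_null_mult_right_bounded[OF F] always_eventually) blast
qed

text \<open>Applying the upper semicontinuity to \<open>z\<close> and to \<open>-z\<close> gives continuity.\<close>

lemma bilinear_limsup_imp_tendsto:
  fixes b :: "nat \<Rightarrow> 'x::real_normed_vector \<Rightarrow> 'y::real_normed_vector \<Rightarrow> real"
  assumes bil: "\<And>n. bilinear (b n)" "bilinear b0"
    and ls: "\<And>z z' \<mu> \<mu>'. z \<rightharpoonup> z' \<Longrightarrow> \<mu> \<rightharpoonup> \<mu>' \<Longrightarrow>
      limsup (\<lambda>n. ereal (b n (0 - z n) (\<mu> n))) \<le> ereal (b0 (0 - z') \<mu>')"
    and z: "z \<rightharpoonup> z'" and \<mu>: "\<mu> \<rightharpoonup> \<mu>'"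
  shows "(\<lambda>n. b n (z n) (\<mu> n)) \<longlonglongrightarrow> b0 z' \<mu>'"
proof -
  have "(\<lambda>n. 0 - z n) \<rightharpoonup> 0 - z'"
    using weakly_converges_scaleR[OF z, of "-1"] by simp
  from ls[OF this \<mu>] have up: "limsup (\<lambda>n. ereal (b n (z n) (\<mu> n))) \<le> ereal (b0 z' \<mu>')"
    by simp
  have lo: "limsup (\<lambda>n. ereal (- b n (z n) (\<mu> n))) \<le> ereal (- b0 z' \<mu>')"
    using ls[OF z \<mu>] by (simp add: bilinear_lneg[OF bil(1)] bilinear_lneg[OF bil(2)])
  show ?thesis
  proof (rule order_tendstoI)
    fix a assume "b0 z' \<mu>' < a"
    then have "limsup (\<lambda>n. ereal (b n (z n) (\<mu> n))) < ereal a"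
      using up by (simp add: le_less_trans)
    from Limsup_lessD[OF this] show "\<forall>\<^sub>F n in sequentially. b n (z n) (\<mu> n) < a" by simp
  next
    fix a assume "a < b0 z' \<mu>'"
    then have "limsup (\<lambda>n. ereal (- b n (z n) (\<mu> n))) < ereal (- a)"
      using lo by (simp add: le_less_trans)
    from Limsup_lessD[OF this] show "\<forall>\<^sub>F n in sequentially. a < b n (z n) (\<mu> n)" by simp
  qed
qed

text \<open>The infimum is taken in the extended reals because V is not known to be bounded below
  until a minimizer has been found.\<close>

lemma minimizing_sequence:
  fixes V :: "'a \<Rightarrow> real"
  assumes "U \<noteq> {}"
  obtains p where "\<And>n. p n \<in> U" "(\<lambda>n. ereal (V (p n))) \<longlonglongrightarrow> (INF q\<in>U. ereal (V q))"
proof -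
  obtain v where v: "\<forall>n. v n \<in> (\<lambda>q. ereal (V q)) ` U" "v \<longlonglongrightarrow> (INF q\<in>U. ereal (V q))"
    using Inf_as_limit[of "(\<lambda>q. ereal (V q)) ` U"] assms by auto
  from v(1) have "\<forall>n. \<exists>q. q \<in> U \<and> v n = ereal (V q)"
    by auto
  then obtain p where p: "\<And>n. p n \<in> U" "\<And>n. v n = ereal (V (p n))"
    by metis
  have "v = (\<lambda>n. ereal (V (p n)))" by (rule ext) (rule p(2))
  with p(1) v(2) show ?thesis by (intro that) simp_all
qed

text \<open>If the norms do not tend to infinity, some bound C is respected infinitely often, and
  those indices are enumerated.\<close>

lemma not_norm_at_top_imp_bounded_subseq:
  fixes w :: "nat \<Rightarrow> 'a::real_normed_vector"
  assumes "\<not> filterlim (\<lambda>n. norm (w n)) at_top sequentially"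
  obtains r C where "strict_mono (r :: nat \<Rightarrow> nat)" "\<And>n. norm (w (r n)) \<le> C"
proof -
  obtain C where "\<not> eventually (\<lambda>n. C < norm (w n)) sequentially"
    using assms by (auto simp: filterlim_at_top_dense)
  then have "infinite {n. norm (w n) \<le> C}"
    by (simp add: not_eventually not_less frequently_cofinite[symmetric] cofinite_eq_sequentially)
  then show ?thesis
    using infinite_enumerate[of "{n. norm (w n) \<le> C}"] that[of _ C] by auto
qed

theorem theorem4p1:
  fixes \<pi> :: "'x::{real_inner, complete_space} \<Rightarrow> 'z::{real_inner, complete_space}"
    and U :: "'w::banach set"
    and A :: "'w \<Rightarrow> 'x \<Rightarrow> 'x" and mA LA :: "'w \<Rightarrow> real"
    and S :: "'w \<Rightarrow> (real \<Rightarrow> 'x) \<Rightarrow> real \<Rightarrow> 'x" and s :: "'w \<Rightarrow> nat \<Rightarrow> real"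
    and b :: "'w \<Rightarrow> 'x \<Rightarrow> 'y::{real_inner, complete_space} \<Rightarrow> real" and Mb \<alpha>b :: "'w \<Rightarrow> real"
    and \<Lambda> :: "'w \<Rightarrow> 'y set"
    and ft :: "'w \<Rightarrow> 'z" and ht :: "'w \<Rightarrow> 'x"
    and \<theta> \<zeta> :: "real \<Rightarrow> real"
    and u :: "'w \<Rightarrow> real \<Rightarrow> 'x" and l :: "'w \<Rightarrow> real \<Rightarrow> 'y"
    and L :: "'x \<Rightarrow> 'y \<Rightarrow> 'w \<Rightarrow> real"
  assumes \<pi>: "bounded_linear \<pi>"
    and W: "reflexive_space TYPE('w)"
    and U: "U \<noteq> {}" "closedin weak_topology U"
    and A: "\<And>p. p \<in> U \<Longrightarrow> strongly_monotone_Lipschitz (mA p) (LA p) (A p)"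
    and S: "\<And>p. p \<in> U \<Longrightarrow> history_dependent (s p) (S p)"
    and b: "\<And>p. p \<in> U \<Longrightarrow> inf_sup_bilinear_form (Mb p) (\<alpha>b p) (b p)"
    and \<Lambda>: "\<And>p. p \<in> U \<Longrightarrow> closed (\<Lambda> p) \<and> convex (\<Lambda> p) \<and> 0 \<in> \<Lambda> p"
    and \<theta>: "continuous_on {0..} \<theta>"
    and \<zeta>: "continuous_on {0..} \<zeta>"
    and sol: "\<And>p. p \<in> U \<Longrightarrow>
        mixed_solution (A p) (S p) (b p) (\<Lambda> p) \<pi> (\<lambda>t. \<theta> t *\<^sub>R ft p) (\<lambda>t. \<zeta> t *\<^sub>R ht p) (u p) (l p)"
    and L: "\<And>un u0 ln l0 pn p. un \<longlonglongrightarrow> u0 \<Longrightarrow> ln \<rightharpoonup> l0 \<Longrightarrow> (\<forall>n. pn n \<in> U) \<Longrightarrow> pn \<rightharpoonup> p \<Longrightarrow>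
        liminf (\<lambda>n. ereal (L (un n) (ln n) (pn n))) \<ge> ereal (L u0 l0 p)"
    and coercive_or_bounded:
      "(\<exists>z :: 'w \<Rightarrow> real. (\<forall>u l. \<forall>p\<in>U. L u l p \<ge> z p) \<and>
          (\<forall>pn. (\<forall>n. pn n \<in> U) \<longrightarrow> filterlim (\<lambda>n. norm (pn n)) at_top sequentially \<longrightarrow>
            filterlim (\<lambda>n. z (pn n)) at_top sequentially))
        \<or> bounded U"
    and H1: "\<And>pn p. (\<forall>n. pn n \<in> U) \<Longrightarrow> pn \<rightharpoonup> p \<Longrightarrow>
        \<exists>F \<delta> :: nat \<Rightarrow> real.
          (\<forall>n. F n \<ge> 0 \<and> \<delta> n \<ge> 0 \<and> (\<forall>v. norm (A (pn n) v - A p v) \<le> F n * (norm v + \<delta> n))) \<and>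
          F \<longlonglongrightarrow> 0 \<and> bounded (range \<delta>)"
    and H2: "\<And>pn p. (\<forall>n. pn n \<in> U) \<Longrightarrow> pn \<rightharpoonup> p \<Longrightarrow>
        \<exists>m0>0. \<exists>L0>0. \<forall>n. mA (pn n) \<ge> m0 \<and> LA (pn n) \<le> L0"
    and H3: "\<And>pn p. (\<forall>n. pn n \<in> U) \<Longrightarrow> pn \<rightharpoonup> p \<Longrightarrow>
        \<exists>F \<delta> :: nat \<Rightarrow> nat \<Rightarrow> real.
          (\<forall>n m. F n m \<ge> 0 \<and> \<delta> n m \<ge> 0 \<and>
            (\<forall>v. continuous_on {0..} v \<longrightarrow> (\<forall>t\<in>{0..real m}.
              norm (S (pn n) v t - S p v t) \<le> F n m * ((SUP r\<in>{0..real m}. norm (v r)) + \<delta> n m)))) \<and>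
          (\<forall>m. (\<lambda>n. F n m) \<longlonglongrightarrow> 0 \<and> bounded (range (\<lambda>n. \<delta> n m)))"
    and H4: "\<And>pn p. (\<forall>n. pn n \<in> U) \<Longrightarrow> pn \<rightharpoonup> p \<Longrightarrow>
        \<forall>m. \<exists>s0>0. \<forall>n. s (pn n) m \<le> s0"
    and H5: "\<And>pn p. (\<forall>n. pn n \<in> U) \<Longrightarrow> pn \<rightharpoonup> p \<Longrightarrow>
        \<forall>zn z \<mu>n \<mu>. zn \<rightharpoonup> z \<longrightarrow> \<mu>n \<rightharpoonup> \<mu> \<longrightarrow>
          (\<forall>w. limsup (\<lambda>n. ereal (b (pn n) (w - zn n) (\<mu>n n))) \<le> ereal (b p (w - z) \<mu>))"
    and H6: "\<And>pn p. (\<forall>n. pn n \<in> U) \<Longrightarrow> pn \<rightharpoonup> p \<Longrightarrow>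
        \<exists>\<alpha>0>0. \<exists>M0>0. \<forall>n. \<alpha>b (pn n) \<ge> \<alpha>0 \<and> Mb (pn n) \<le> M0"
    and H7: "\<And>pn p. (\<forall>n. pn n \<in> U) \<Longrightarrow> pn \<rightharpoonup> p \<Longrightarrow>
        \<forall>vn v. vn \<rightharpoonup> v \<longrightarrow> (\<lambda>n. \<pi> (vn n)) \<longlonglongrightarrow> \<pi> v"
    and H8: "\<And>pn p. (\<forall>n. pn n \<in> U) \<Longrightarrow> pn \<rightharpoonup> p \<Longrightarrow>
        Mosco_converges (\<lambda>n. \<Lambda> (pn n)) (\<Lambda> p)"
    and H9: "\<And>pn p. (\<forall>n. pn n \<in> U) \<Longrightarrow> pn \<rightharpoonup> p \<Longrightarrow>
        (\<lambda>n. ft (pn n)) \<rightharpoonup> ft p \<and> (\<lambda>n. ht (pn n)) \<rightharpoonup> ht p"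
  shows "\<forall>t\<ge>0. \<exists>ps\<in>U. \<forall>p\<in>U. L (u ps t) (l ps t) ps \<le> L (u p t) (l p t) p"
proof -
  \<comment> \<open>Stated for arbitrary weakly convergent parameters. The hypotheses cover all such
    sequences and hence their subsequences, which is what the control of forms and constraint sets
    along subsequences requires.\<close>
  have solutions_converge: "\<exists>r. strict_mono (r :: nat \<Rightarrow> nat) \<and> (\<lambda>n. u (pn (r n)) t) \<longlonglongrightarrow> u p t \<and>
      (\<lambda>n. l (pn (r n)) t) \<rightharpoonup> l p t"
    if pn: "\<forall>n. pn n \<in> U" and conv: "pn \<rightharpoonup> p" and p: "p \<in> U" and t: "0 \<le> t" for pn p t
  proof -
    have pnU: "pn n \<in> U" for n using pn by blast
    have subseq: "\<forall>n. (pn \<circ> r) n \<in> U" "(pn \<circ> r) \<rightharpoonup> p" if "strict_mono r" for r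
      using pn weakly_converges_subseq[OF conv that] by auto
    obtain m0 L0 where m0: "m0 > 0" and L0: "L0 > 0"
      and mL: "\<And>n. m0 \<le> mA (pn n)" "\<And>n. LA (pn n) \<le> L0"
      using H2[OF pn conv] by blast
    obtain s0 where s0: "\<And>m. s0 m > 0" "\<And>m n. s (pn n) m \<le> s0 m"
      using H4[OF pn conv] by metis
    obtain \<alpha>0 where \<alpha>0: "\<alpha>0 > 0" "\<And>n. \<alpha>0 \<le> \<alpha>b (pn n)"
      using H6[OF pn conv] by blast
    obtain F \<delta> where F: "\<And>n v. norm (A (pn n) v - A p v) \<le> F n * (norm v + \<delta> n)"
        "F \<longlonglongrightarrow> 0" "bounded (range \<delta>)"
      using H1[OF pn conv] by blast
    obtain G \<gamma> where G: "\<And>n m v t. continuous_on {0..} v \<Longrightarrow> t \<in> {0..real m} \<Longrightarrow>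
          norm (S (pn n) v t - S p v t) \<le> G n m * ((SUP r\<in>{0..real m}. norm (v r)) + \<gamma> n m)"
        "\<And>m. (\<lambda>n. G n m) \<longlonglongrightarrow> 0" "\<And>m. bounded (range (\<lambda>n. \<gamma> n m))"
      using H3[OF pn conv] by blast
    have bil: "bilinear (b q)" if "q \<in> U" for q
      using b[OF that] by (simp add: inf_sup_bilinear_form_def)
    interpret convergent_mixed_problems \<pi> "\<lambda>n. A (pn n)" "A p" "\<lambda>n. S (pn n)" "S p"
      "\<lambda>n. b (pn n)" "b p" "\<lambda>n. \<Lambda> (pn n)" "\<Lambda> p"
      "\<lambda>n t. \<theta> t *\<^sub>R ft (pn n)" "\<lambda>t. \<theta> t *\<^sub>R ft p" "\<lambda>n t. \<zeta> t *\<^sub>R ht (pn n)" "\<lambda>t. \<zeta> t *\<^sub>R ht p"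
      "\<lambda>n. u (pn n)" "u p" "\<lambda>n. l (pn n)" "l p" m0 L0 \<alpha>0 s0
    proof (rule convergent_mixed_problems.intro)
      show "bounded_linear \<pi>" "m0 > 0" "L0 > 0" "\<alpha>0 > 0" by fact+
      show "0 \<le> s0 m" for m using s0(1)[of m] by simp
      show "(\<lambda>n. \<pi> (v n)) \<longlonglongrightarrow> \<pi> v'" if "v \<rightharpoonup> v'" for v v'
        using H7[OF pn conv] that by blast
      show "m0 * (norm (v - w))\<^sup>2 \<le> (A (pn n) v - A (pn n) w) \<bullet> (v - w)" for n v w
        using A[OF pnU[of n]] mult_right_mono[OF mL(1)[of n], of "(norm (v - w))\<^sup>2"]
        unfolding strongly_monotone_Lipschitz_def by (meson order_trans zero_le_power2)
      show "norm (A (pn n) v - A (pn n) w) \<le> L0 * norm (v - w)" for n v w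
        using A[OF pnU[of n]] mult_right_mono[OF mL(2)[of n], of "norm (v - w)"]
        unfolding strongly_monotone_Lipschitz_def by (meson order_trans norm_ge_zero)
      show "(\<lambda>n. A (pn n) v) \<longlonglongrightarrow> A p v" for v
        by (rule LIM_zero_cancel, rule Lim_null_comparison[OF always_eventually
              tendsto_mult_add_bounded_0[OF F(2,3)]]) (use F(1) in blast)
      show "norm (S (pn n) v t - S (pn n) w t) \<le> s0 m * integral {0..t} (\<lambda>r. norm (v r - w r))"
        if v: "continuous_on {0..} v" and w: "continuous_on {0..} w" and t: "t \<in> {0..real m}" for n m v w t
      proof -
        have "0 \<le> integral {0..t} (\<lambda>r. norm (v r - w r))"
          by (intro integral_nonneg integrable_continuous_real continuous_intros
              continuous_on_subset[OF v] continuous_on_subset[OF w]) auto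
        from mult_right_mono[OF s0(2) this] show ?thesis
          using S[OF pnU[of n]] v w t unfolding history_dependent_def by (meson order_trans)
      qed
      show "(\<lambda>n. S (pn n) v t) \<longlonglongrightarrow> S p v t" if v: "continuous_on {0..} v" and "0 \<le> t" for v t
      proof -
        obtain m where "t \<le> real m" using real_arch_simple by blast
        with \<open>0 \<le> t\<close> have "t \<in> {0..real m}" by simp
        then show ?thesis
          by (intro LIM_zero_cancel[OF Lim_null_comparison[OF always_eventually
                tendsto_mult_add_bounded_0[OF G(2,3)]]]) (use G(1)[OF v] in blast)
      qed
      \<comment> \<open>For the limit parameter the image of the zero function is bounded on the
        interval by continuity; the deviation bound is free of t and tends to 0 in n, so it is
        bounded as well.\<close>
      show "\<exists>K. \<forall>n. \<forall>t\<in>{0..real m}. norm (S (pn n) (\<lambda>_. 0) t) \<le> K" for m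
      proof -
        have 0: "continuous_on {0..} (\<lambda>_::real. 0::'x)" by simp
        define c where "c = (SUP r\<in>{0..real m}. norm ((\<lambda>_::real. 0::'x) r))"
        obtain K1 where K1: "\<And>t. t \<in> {0..real m} \<Longrightarrow> norm (S p (\<lambda>_. 0) t) \<le> K1"
          using continuous_on_atLeast_bounded[OF history_dependent_continuous[OF S[OF p] 0]] by metis
        obtain K2 where K2: "\<And>n. norm (G n m * (c + \<gamma> n m)) \<le> K2"
          using convergent_imp_Bseq[OF convergentI[OF tendsto_mult_add_bounded_0[OF G(2)[of m] G(3)[of m], of c]]]
          by (auto simp: Bseq_def)
        have "norm (S (pn n) (\<lambda>_. 0) t) \<le> K1 + K2" if "t \<in> {0..real m}" for n t
          using G(1)[OF 0 that, of n] K1[OF that] K2[of n]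
            norm_triangle_sub[of "S (pn n) (\<lambda>_. 0) t" "S p (\<lambda>_. 0) t"]
          unfolding c_def[symmetric] real_norm_def by linarith
        then show ?thesis by blast
      qed
      show "bilinear (b (pn n))" "bilinear (b p)" for n
        using bil pnU p by auto
      show "\<alpha>0 * norm \<mu> \<le> K" if "0 \<le> K" "\<And>v. b (pn n) v \<mu> \<le> K * norm v" for n K \<mu>
        using inf_sup_bound[OF b[OF pnU[of n]] that] mult_right_mono[OF \<alpha>0(2)[of n], of "norm \<mu>"]
        by simp
      show "\<mu> = 0" if "\<And>v. b p v \<mu> = 0" for \<mu>
      proof -
        have "\<alpha>b p * norm \<mu> \<le> 0" using that by (intro inf_sup_bound[OF b[OF p]]) auto
        moreover have "\<alpha>b p > 0" using b[OF p] by (simp add: inf_sup_bilinear_form_def)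
        ultimately show ?thesis by (simp add: mult_le_0_iff)
      qed
      show "(\<lambda>n. b (pn (r n)) (z n) (\<mu>n n)) \<longlonglongrightarrow> b p z' \<mu>"
        if r: "strict_mono r" and z: "z \<rightharpoonup> z'" and \<mu>: "\<mu>n \<rightharpoonup> \<mu>" for r z z' \<mu>n \<mu>
        by (rule bilinear_limsup_imp_tendsto[OF bil[OF pnU] bil[OF p] _ z \<mu>])
          (use H5[OF subseq[OF r], unfolded o_apply] in blast)
      show "0 \<in> \<Lambda> (pn n)" for n
        using \<Lambda>[OF pnU] by blast
      show "\<exists>\<mu>n. (\<forall>n. \<mu>n n \<in> \<Lambda> (pn n)) \<and> \<mu>n \<longlonglongrightarrow> \<mu>" if "\<mu> \<in> \<Lambda> p" for \<mu>
        using H8[OF pn conv] that by (rule Mosco_converges_strong)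
      show "\<mu> \<in> \<Lambda> p" if "strict_mono r" "\<And>n. \<mu>n n \<in> \<Lambda> (pn (r n))" "\<mu>n \<rightharpoonup> \<mu>" for r \<mu>n \<mu>
        by (rule Mosco_converges_weak[OF H8[OF subseq[OF that(1)], unfolded o_apply] that(2,3)])
      have data: "(\<lambda>n. ft (pn n)) \<rightharpoonup> ft p" "(\<lambda>n. ht (pn n)) \<rightharpoonup> ht p"
        using H9[OF pn conv] by auto
      then show "(\<lambda>n. \<theta> t *\<^sub>R ft (pn n)) \<rightharpoonup> \<theta> t *\<^sub>R ft p" "(\<lambda>n. \<zeta> t *\<^sub>R ht (pn n)) \<rightharpoonup> \<zeta> t *\<^sub>R ht p" for t
        by (simp_all add: weakly_converges_scaleR)
      show "\<exists>K. \<forall>n. \<forall>t\<in>{0..real m}. norm (\<theta> t *\<^sub>R ft (pn n)) \<le> K"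
        "\<exists>K. \<forall>n. \<forall>t\<in>{0..real m}. norm (\<zeta> t *\<^sub>R ht (pn n)) \<le> K" for m
        using scaleR_weakly_converges_bounded[OF \<theta> data(1)] scaleR_weakly_converges_bounded[OF \<zeta> data(2)]
        by simp_all
      show "mixed_solution (A (pn n)) (S (pn n)) (b (pn n)) (\<Lambda> (pn n)) \<pi> (\<lambda>t. \<theta> t *\<^sub>R ft (pn n))
          (\<lambda>t. \<zeta> t *\<^sub>R ht (pn n)) (u (pn n)) (l (pn n))" for n
        by (rule sol[OF pnU])
      show "mixed_solution (A p) (S p) (b p) (\<Lambda> p) \<pi> (\<lambda>t. \<theta> t *\<^sub>R ft p) (\<lambda>t. \<zeta> t *\<^sub>R ht p) (u p) (l p)"
        by (rule sol[OF p])
    qed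
    show ?thesis
      using solutions_convergent_subsequence[OF t] by metis
  qed
  show ?thesis
  proof (intro allI impI)
    fix t :: real assume t: "0 \<le> t"
    define V where "V p = L (u p t) (l p t) p" for p
    obtain pn where pn: "\<And>n. pn n \<in> U" and V: "(\<lambda>n. ereal (V (pn n))) \<longlonglongrightarrow> (INF q\<in>U. ereal (V q))"
      using minimizing_sequence[OF U(1)] by metis
    \<comment> \<open>For unbounded U, a sequence with no bounded subsequence would by coercivity
      have costs tending to infinity, while the infimum is at most the real number
      \<open>V (pn 0)\<close>.\<close>
    have "\<exists>r C. strict_mono (r :: nat \<Rightarrow> nat) \<and> (\<forall>n. norm (pn (r n)) \<le> C)"
    proof (cases "bounded U")
      case True
      then obtain C where "\<And>q. q \<in> U \<Longrightarrow> norm q \<le> C" by (auto simp: bounded_iff)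
      with pn strict_mono_id show ?thesis by (metis id_apply)
    next
      case False
      then obtain z where z: "\<And>u l p. p \<in> U \<Longrightarrow> L u l p \<ge> z p"
        "filterlim (\<lambda>n. norm (pn n)) at_top sequentially \<Longrightarrow> filterlim (\<lambda>n. z (pn n)) at_top sequentially"
        using coercive_or_bounded pn by blast
      have "\<not> filterlim (\<lambda>n. norm (pn n)) at_top sequentially"
      proof
        assume "filterlim (\<lambda>n. norm (pn n)) at_top sequentially"
        from z(2)[OF this] have "filterlim (\<lambda>n. V (pn n)) at_top sequentially"
          by (rule filterlim_at_top_mono) (simp add: V_def z(1) pn)
        then have "(\<lambda>n. ereal (V (pn n))) \<longlonglongrightarrow> \<infinity>"
          by (simp add: tendsto_PInfty_eq_at_top)
        with V have "(INF q\<in>U. ereal (V q)) = \<infinity>"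
          by (rule LIMSEQ_unique)
        moreover have "(INF q\<in>U. ereal (V q)) \<le> ereal (V (pn 0))"
          by (rule INF_lower[OF pn])
        ultimately show False by simp
      qed
      then show ?thesis
        using not_norm_at_top_imp_bounded_subseq[of pn] by metis
    qed
    then obtain r C where r: "strict_mono (r :: nat \<Rightarrow> nat)" "\<And>n. norm (pn (r n)) \<le> C" by blast
    obtain r' p where r': "strict_mono (r' :: nat \<Rightarrow> nat)" "((\<lambda>n. pn (r n)) \<circ> r') \<rightharpoonup> p"
      using reflexive_weakly_convergent_subsequence[OF W, of "\<lambda>n. pn (r n)" C] r(2) by metis
    define qn where "qn n = pn (r (r' n))" for n
    have qn: "\<forall>n. qn n \<in> U" and q_conv: "qn \<rightharpoonup> p"
      using pn r'(2) by (simp_all add: qn_def[abs_def] o_def)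
    have pU: "p \<in> U"
      by (rule limitin_closedin[OF q_conv[unfolded weakly_converges_iff_limitin] U(2)]) (use qn in auto)
    obtain k where k: "strict_mono (k :: nat \<Rightarrow> nat)" "(\<lambda>n. u (qn (k n)) t) \<longlonglongrightarrow> u p t"
        "(\<lambda>n. l (qn (k n)) t) \<rightharpoonup> l p t"
      using solutions_converge[OF qn q_conv pU t] by blast
    have "(\<lambda>n. qn (k n)) \<rightharpoonup> p"
      using weakly_converges_subseq[OF q_conv k(1)] by (simp add: o_def)
    \<comment> \<open>Lower semicontinuity is used along the last subsequence, which is still
      minimizing.\<close>
    from L[OF k(2,3) _ this] have "ereal (V p) \<le> liminf (\<lambda>n. ereal (V (qn (k n))))"
      using qn by (simp add: V_def)
    moreover have "(\<lambda>n. ereal (V (qn (k n)))) \<longlonglongrightarrow> (INF q\<in>U. ereal (V q))"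
      using LIMSEQ_subseq_LIMSEQ[OF V strict_mono_o[OF r(1) strict_mono_o[OF r'(1) k(1)]]]
      by (simp add: qn_def o_def)
    ultimately have "ereal (V p) \<le> (INF q\<in>U. ereal (V q))"
      by (simp add: lim_imp_Liminf)
    then have "V p \<le> V q" if "q \<in> U" for q
      using INF_lower[OF that, of "\<lambda>q. ereal (V q)"] by (metis ereal_less_eq(3) order_trans)
    with pU show "\<exists>ps\<in>U. \<forall>p\<in>U. L (u ps t) (l ps t) ps \<le> L (u p t) (l p t) p"
      by (auto simp: V_def)
  qed
qed

end
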